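(* Let $g:\mathbb{R}\to(1,\infty)$ be a non-constant (real) analytic function and let $b:\mathbb{N}\to\mathbb{R}$ be a scattered sequence that tends to $\infty$. Let $k\in\mathbb{N}$, let $p_1,\dots,p_k\in\mathbb{R}[x]$ be non-constant polynomials and let $a_1,\dots,a_k:\mathbb{N}\to\mathbb{R}$ be scattered sequences. Assume that either (1) the sequences $a_1,\dots,a_k$ are jointly scattered, or (2) the polynomials $\{1,p_1,\dots,p_k\}$ are linearly independent over $\mathbb{R}$. Then, for Lebesgue-almost every $x\in\mathbb{R}$, the sequence $\big(g(x)^{b(n)},a_1(n)p_1(x),\dots,a_k(n)p_k(x)\big)_{n\in\mathbb{N}}$ is uniformly distributed in $\mathbb{T}^{k+1}$.
   Context: $\mathbb{N}=\{1,2,\dots\}$, $\mathbb{T}^d=\mathbb{R}^d/\mathbb{Z}^d$. A sequence $(x_n)_{n\in\mathbb{N}}$ in $\mathbb{R}^d$ is uniformly distributed in $\mathbb{T}^d$ (equivalently, uniformly distributed modulo 1) if for all intervals $I_1,\dots,I_d\subset[0,1]$, $\lim_{N\to\infty}\frac1N|\{n\in\{1,\dots,N\}:\{x_n\}\in I_1\times\cdots\times I_d\}|=\mu(I_1\times\cdots\times I_d)$, where $\mu$ is $d$-dimensional Lebesgue measure and $\{y\}$ is the vector of coordinatewise fractional parts of $y\in\mathbb{R}^d$. For $\delta\in(0,1]$, a sequence $a:\mathbb{N}\to\mathbb{R}$ is $\delta$-scattered if there exists $\epsilon>0$ such that for every sufficiently large $N$, $\frac1{N^2}\sum_{1\le m<n\le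 N}\min\big(|a(n)-a(m)|^{-\delta},1\big)\le\frac1{(\log N)^{1+\epsilon}}$ (with the term equal to $1$ when $a(n)=a(m)$). The sequence $a$ is scattered if it is $\delta$-scattered for every $\delta\in(0,1]$. Sequences $a_1,\dots,a_k:\mathbb{N}\to\mathbb{R}$ are jointly scattered if for every non-zero $v=(v_1,\dots,v_k)\in\mathbb{R}^k$ the sequence $v_1a_1+\cdots+v_ka_k$ is scattered. Linear independence of $\{1,p_1,\dots,p_k\}$ is meant for the family (no nontrivial real linear combination of $1,p_1,\dots,p_k$ vanishes identically). *)

theory Defs
  imports "HOL-Analysis.Analysis" "HOL-Computational_Algebra.Polynomial"
begin

text \<open>Sequences indexed by \<open>{1, 2, \<dots>}\<close> are functions on \<^typ>\<open>nat\<close> whose value at \<open>0\<close> is never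
  used.\<close>

definition uniformly_distributed_mod1 :: "(nat \<Rightarrow> real ^ 'd) \<Rightarrow> bool" where
  "uniformly_distributed_mod1 x \<longleftrightarrow>
     (\<forall>I :: 'd \<Rightarrow> real set. (\<forall>i. is_interval (I i) \<and> I i \<subseteq> {0..1}) \<longrightarrow>
        (\<lambda>N. real (card {n \<in> {1..N}. \<forall>i. frac (x n $ i) \<in> I i}) / real N)
          \<longlonglongrightarrow> measure lebesgue {y :: real ^ 'd. \<forall>i. y $ i \<in> I i})"

text \<open>The case distinction is needed because \<open>0 powr s = 0\<close> in HOL.\<close>

definition delta_scattered :: "real \<Rightarrow> (nat \<Rightarrow> real) \<Rightarrow> bool" where
  "delta_scattered \<delta> a \<longleftrightarrow>
     (\<exists>\<epsilon>>0. \<forall>\<^sub>F N in sequentially.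
        1 / (real N)\<^sup>2 *
          (\<Sum>n\<in>{1..N}. \<Sum>m\<in>{1..<n}.
             if a n = a m then 1 else min (\<bar>a n - a m\<bar> powr (- \<delta>)) 1)
        \<le> 1 / ln (real N) powr (1 + \<epsilon>))"

definition scattered :: "(nat \<Rightarrow> real) \<Rightarrow> bool" where
  "scattered a \<longleftrightarrow> (\<forall>\<delta>\<in>{0<..1}. delta_scattered \<delta> a)"

definition jointly_scattered :: "('k::finite \<Rightarrow> nat \<Rightarrow> real) \<Rightarrow> bool" where
  "jointly_scattered a \<longleftrightarrow>
     (\<forall>v :: real ^ 'k. v \<noteq> 0 \<longrightarrow> scattered (\<lambda>n. \<Sum>i\<in>UNIV. v $ i * a i n))"

definition real_analytic :: "(real \<Rightarrow> real) \<Rightarrow> bool" where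
  "real_analytic g \<longleftrightarrow> (\<forall>x. \<exists>F. (\<lambda>h. g (x + h)) has_fps_expansion F)"

text \<open>Independence of a family, not of its range: repeated members make it dependent.\<close>

definition independent_poly_family :: "('i::finite \<Rightarrow> real poly) \<Rightarrow> bool" where
  "independent_poly_family q \<longleftrightarrow>
     (\<forall>c :: 'i \<Rightarrow> real. (\<Sum>i\<in>UNIV. smult (c i) (q i)) = 0 \<longrightarrow> (\<forall>i. c i = 0))"

end

theory Submission
  imports Defs "HOL-Real_Asymp.Real_Asymp"
begin

text \<open>By Weyl's criterion it suffices that, for fixed \<open>(L, l) \<noteq> 0\<close> and almost every \<open>x\<close>, the averages of
  \<open>cis (\<phi> n x)\<close> tend to \<open>0\<close>, where \<open>\<phi> n x = L * g x powr b n + (\<Sum>i. l i * a i n * poly (p i) x)\<close>.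
  On a short interval the mean square of such an average is governed by the integrals of
  \<open>cis (\<phi> n - \<phi> m)\<close>. If \<open>L \<noteq> 0\<close>, differentiating once more than the degree of the polynomials kills them,
  while away from the zeros of \<open>deriv g\<close> the same derivative of \<open>g powr b n - g powr b m\<close> is at least a
  multiple of \<open>\<bar>b n - b m\<bar>\<close>. If \<open>L = 0\<close>, the polynomial \<open>\<phi> n - \<phi> m\<close> has a non-constant coefficient that
  dominates \<open>\<bar>s n - s m\<bar>\<close> for a scattered sequence \<open>s\<close>. In both cases van der Corput's lemma bounds the
  integral by a power of the difference, scatteredness gives a mean square of
  \<open>O((ln N) powr - (1 + \<epsilon>))\<close>, and such a bound implies almost everywhere convergence (Davenport,
  Erdos, LeVeque).\<close>

section \<open>Van der Corput's lemma\<close>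

text \<open>The coefficients \<open>a i n - a i m\<close> in the polynomial part of
  \<open>\<phi> n - \<phi> m\<close> are not controlled by \<open>b n - b m\<close>, and they can
  nearly cancel against each other. Hence every bound for an oscillatory integral is uniform in the
  polynomial: its constants depend only on the degree bound, the interval, \<open>g\<close> and
  \<open>L\<close>. A derivative bound of order r saves only the power 1/r, so with D bounding the
  degrees the exponents that arise are 1/(D+1) and 1/D; scatteredness is applied at exactly these
  \<delta>. The lower bound for the derivatives of \<open>g powr b n - g powr b m\<close> comes from
  the mean value theorem in the exponent, not in x: \<open>1 < g\<close> makes \<open>ln g\<close>
  positive, and for large exponents the top power of the exponent wins. The finitely many n with
  \<open>b n\<close> still too small add only O(1/N) to the mean square. For \<open>L = 0\<close>
  the two alternatives exclude cancellation differently: joint scatteredness makes one fixed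
  coefficient a scattered sequence, independence prevents all non-constant coefficients from being
  small together.\<close>

lemma norm_integral_cis_le_length:
  fixes \<phi> :: "real \<Rightarrow> real"
  assumes "a \<le> b" "continuous_on {a..b} \<phi>"
  shows "norm (integral {a..b} (\<lambda>x. cis (\<phi> x))) \<le> b - a"
proof -
  have "norm (integral {a..b} (\<lambda>x. cis (\<phi> x))) \<le> 1 * (b - a)"
    by (rule integral_bound) (use assms in \<open>auto intro!: continuous_intros\<close>)
  then show ?thesis by simp
qed

lemma norm_integral_cis_minus:
  fixes \<phi> :: "real \<Rightarrow> real"
  assumes "continuous_on {a..b} \<phi>"
  shows "norm (integral {a..b} (\<lambda>x. cis (- \<phi> x))) = norm (integral {a..b} (\<lambda>x. cis (\<phi> x)))"
proof -
  have "(\<lambda>x. cis (\<phi> x)) integrable_on {a..b}"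
    using assms by (intro integrable_continuous_real continuous_intros)
  then have "integral {a..b} (\<lambda>x. cnj (cis (\<phi> x))) = cnj (integral {a..b} (\<lambda>x. cis (\<phi> x)))"
    by (intro integral_unique has_integral_cnj[unfolded o_def, THEN iffD2] integrable_integral)
  then show ?thesis by (simp add: cis_cnj)
qed

text \<open>Integration by parts against \<open>1 / \<phi>'\<close>, carried out as an application of the fundamental
  theorem to \<open>cis \<phi> / (\<i> \<phi>')\<close>.\<close>

lemma van_der_corput_first:
  fixes \<phi> \<phi>' \<phi>'' h :: "real \<Rightarrow> real"
  assumes ab: "a \<le> b" and \<mu>: "0 < \<mu>"
    and d1: "\<And>x. x \<in> {a..b} \<Longrightarrow> (\<phi> has_real_derivative \<phi>' x) (at x within {a..b})"
    and d2: "\<And>x. x \<in> {a..b} \<Longrightarrow> (\<phi>' has_real_derivative \<phi>'' x) (at x within {a..b})"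
    and lb: "\<And>x. x \<in> {a..b} \<Longrightarrow> \<mu> \<le> \<bar>\<phi>' x\<bar>"
    and h: "(h has_integral H) {a..b}" "\<And>x. x \<in> {a..b} \<Longrightarrow> \<bar>\<phi>'' x\<bar> / (\<phi>' x)\<^sup>2 \<le> h x"
  shows "norm (integral {a..b} (\<lambda>x. cis (\<phi> x))) \<le> 2 / \<mu> + H"
proof -
  define G where "G x = - \<i> * (cis (\<phi> x) * of_real (1 / \<phi>' x))" for x
  define R where "R x = - \<i> * (cis (\<phi> x) * of_real (\<phi>'' x / (\<phi>' x)\<^sup>2))" for x
  have nz: "\<phi>' x \<noteq> 0" if "x \<in> {a..b}" for x using lb[OF that] \<mu> by auto
  have dc: "((\<lambda>x. cis (\<phi> x)) has_vector_derivative \<i> * cis (\<phi> x) * of_real (\<phi>' x)) (at x within {a..b})"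
    if "x \<in> {a..b}" for x
  proof -
    have "((\<lambda>x. cis (\<phi> x)) has_derivative (\<lambda>h. (\<phi>' x * h) *\<^sub>R (\<i> * cis (\<phi> x)))) (at x within {a..b})"
      using d1[OF that] unfolding has_field_derivative_def
      by (auto intro!: derivative_eq_intros)
    then show ?thesis
      unfolding has_vector_derivative_def by (simp add: scaleR_conv_of_real mult_ac)
  qed
  have "(G has_vector_derivative (cis (\<phi> x) - R x)) (at x within {a..b})" if x: "x \<in> {a..b}" for x
  proof -
    have "((\<lambda>x. 1 / \<phi>' x) has_real_derivative (- \<phi>'' x / (\<phi>' x)\<^sup>2)) (at x within {a..b})"
      using d2[OF x] nz[OF x] by (auto intro!: derivative_eq_intros simp: power2_eq_square)
    then have "((\<lambda>x. complex_of_real (1 / \<phi>' x)) has_vector_derivative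
        complex_of_real (- \<phi>'' x / (\<phi>' x)\<^sup>2)) (at x within {a..b})"
      by (simp only: has_real_derivative_iff_has_vector_derivative has_vector_derivative_of_real)
    from has_vector_derivative_mult[OF dc[OF x] this]
    have "((\<lambda>x. - \<i> * (cis (\<phi> x) * complex_of_real (1 / \<phi>' x))) has_vector_derivative
       - \<i> * (cis (\<phi> x) * complex_of_real (- \<phi>'' x / (\<phi>' x)\<^sup>2)
          + \<i> * cis (\<phi> x) * of_real (\<phi>' x) * complex_of_real (1 / \<phi>' x))) (at x within {a..b})"
      by (intro has_vector_derivative_mult_right)
    moreover have "- \<i> * (cis (\<phi> x) * complex_of_real (- \<phi>'' x / (\<phi>' x)\<^sup>2)
          + \<i> * cis (\<phi> x) * of_real (\<phi>' x) * complex_of_real (1 / \<phi>' x)) = cis (\<phi> x) - R x"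
      using nz[OF x] by (simp add: R_def algebra_simps)
    ultimately show ?thesis by (simp add: G_def[abs_def])
  qed
  then have 1: "((\<lambda>x. cis (\<phi> x) - R x) has_integral (G b - G a)) {a..b}"
    using ab by (intro fundamental_theorem_of_calculus) auto
  have cont: "continuous_on {a..b} \<phi>"
    using d1 by (meson DERIV_isCont continuous_on_eq_continuous_within DERIV_continuous)
  then have ic: "(\<lambda>x. cis (\<phi> x)) integrable_on {a..b}"
    by (intro integrable_continuous_real continuous_intros)
  \<comment> \<open>\<open>\<phi>''\<close> is not assumed continuous. Integrability of
    \<open>R\<close> is obtained as that of a difference: \<open>cis \<phi>\<close> is continuous
    and \<open>cis \<phi> - R\<close> is the exact derivative of \<open>G\<close>.\<close>
  have "((\<lambda>x. cis (\<phi> x) - (cis (\<phi> x) - R x)) has_integral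
      (integral {a..b} (\<lambda>x. cis (\<phi> x)) - (G b - G a))) {a..b}"
    by (intro has_integral_diff 1 integrable_integral ic)
  then have 2: "(R has_integral (integral {a..b} (\<lambda>x. cis (\<phi> x)) - (G b - G a))) {a..b}"
    by simp
  have "norm (R x) = \<bar>\<phi>'' x\<bar> / (\<phi>' x)\<^sup>2" for x
    by (simp add: R_def norm_mult norm_divide norm_power)
  then have "norm (integral {a..b} R) \<le> integral {a..b} h"
    using 2 h by (intro integral_norm_bound_integral) auto
  then have "norm (integral {a..b} (\<lambda>x. cis (\<phi> x)) - (G b - G a)) \<le> H"
    using 2 h(1) by (simp add: integral_unique)
  moreover have "norm (G x) \<le> 1 / \<mu>" if "x \<in> {a..b}" for x
    using lb[OF that] \<mu> by (simp add: G_def norm_divide norm_mult frac_le)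
  then have "norm (G b - G a) \<le> 1 / \<mu> + 1 / \<mu>"
    using ab by (intro order.trans[OF norm_triangle_ineq4] add_mono) auto
  ultimately show ?thesis
    using norm_triangle_sub[of "integral {a..b} (\<lambda>x. cis (\<phi> x))" "G b - G a"] by simp
qed

text \<open>Here the error integrand of \<open>van_der_corput_first\<close> is the derivative of
  \<open>- 1 / \<phi>'\<close>, so it integrates to boundary values. As \<open>\<phi>'\<close> has a
  fixed sign, one of them is non-positive and the other at most \<open>1 / \<mu>\<close>, whatever
  the length of the interval.\<close>

lemma van_der_corput_first_monotone:
  fixes \<phi> \<phi>' \<phi>'' :: "real \<Rightarrow> real"
  assumes ab: "a \<le> b" and \<mu>: "0 < \<mu>"
    and d1: "\<And>x. x \<in> {a..b} \<Longrightarrow> (\<phi> has_real_derivative \<phi>' x) (at x within {a..b})"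
    and d2: "\<And>x. x \<in> {a..b} \<Longrightarrow> (\<phi>' has_real_derivative \<phi>'' x) (at x within {a..b})"
    and convex: "\<And>x. x \<in> {a..b} \<Longrightarrow> 0 \<le> \<phi>'' x"
    and lb: "(\<forall>x\<in>{a..b}. \<mu> \<le> \<phi>' x) \<or> (\<forall>x\<in>{a..b}. \<phi>' x \<le> - \<mu>)"
  shows "norm (integral {a..b} (\<lambda>x. cis (\<phi> x))) \<le> 3 / \<mu>"
proof -
  have nz: "\<phi>' x \<noteq> 0" if "x \<in> {a..b}" for x using lb \<mu> that by force
  have H: "((\<lambda>x. \<phi>'' x / (\<phi>' x)\<^sup>2) has_integral (- 1 / \<phi>' b - (- 1 / \<phi>' a))) {a..b}" (is "(_ has_integral ?H) _")
  proof (rule fundamental_theorem_of_calculus[OF ab])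
    fix x assume x: "x \<in> {a..b}"
    show "((\<lambda>x. - 1 / \<phi>' x) has_vector_derivative \<phi>'' x / (\<phi>' x)\<^sup>2) (at x within {a..b})"
      unfolding has_real_derivative_iff_has_vector_derivative[symmetric]
      using d2[OF x] nz[OF x] by (auto intro!: derivative_eq_intros simp: power2_eq_square)
  qed
  have "norm (integral {a..b} (\<lambda>x. cis (\<phi> x))) \<le> 2 / \<mu> + ?H"
  proof (rule van_der_corput_first[OF ab \<mu> d1 d2 _ H])
    show "\<mu> \<le> \<bar>\<phi>' x\<bar>" if "x \<in> {a..b}" for x using lb that by force
    show "\<bar>\<phi>'' x\<bar> / (\<phi>' x)\<^sup>2 \<le> \<phi>'' x / (\<phi>' x)\<^sup>2" if "x \<in> {a..b}" for x
      using convex[OF that] by simp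
  qed auto
  also have "?H \<le> 1 / \<mu>"
    using lb
  proof
    assume *: "\<forall>x\<in>{a..b}. \<mu> \<le> \<phi>' x"
    then have "1 / \<phi>' a \<le> 1 / \<mu>" "0 \<le> 1 / \<phi>' b"
      using ab \<mu> by (auto intro!: divide_left_mono mult_pos_pos intro: order.trans[of 0 \<mu>] order.strict_trans2[of 0 \<mu>])
    then show ?thesis unfolding minus_divide_left[symmetric] by linarith
  next
    assume *: "\<forall>x\<in>{a..b}. \<phi>' x \<le> - \<mu>"
    then have "\<mu> \<le> - \<phi>' b" "\<mu> \<le> - \<phi>' a" using ab by force+
    then have "1 / (- \<phi>' b) \<le> 1 / \<mu>" "0 \<le> 1 / (- \<phi>' a)"
      using \<mu> by (auto intro!: divide_left_mono mult_pos_pos simp del: divide_minus_right)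
    then show ?thesis unfolding minus_divide_left[symmetric] divide_minus_right by linarith
  qed
  finally show ?thesis by (simp add: field_simps)
qed

text \<open>\<open>\<psi>\<close> grows at rate at least \<open>\<kappa>\<close>, so
  \<open>\<bar>\<psi>\<bar>\<close> can be below \<open>\<delta> * \<kappa>\<close> only within
  distance \<open>\<delta>\<close> of one point. That window costs its length, at most
  \<open>2 * \<delta>\<close>, and each side of it costs \<open>B\<close>. The bound
  \<open>B\<close> is abstract so that the lemma serves both the base case and the induction step
  below.\<close>

lemma van_der_corput_split:
  fixes \<phi> \<psi> \<psi>' :: "real \<Rightarrow> real"
  assumes ab: "a \<le> b" and cont: "continuous_on {a..b} \<phi>" and pos: "0 < \<delta>" "0 < \<kappa>" "0 \<le> B"
    and d: "\<And>x. x \<in> {a..b} \<Longrightarrow> (\<psi> has_real_derivative \<psi>' x) (at x within {a..b})"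
    and lb: "\<And>x. x \<in> {a..b} \<Longrightarrow> \<kappa> \<le> \<psi>' x"
    and B: "\<And>u v. \<lbrakk>a \<le> u; u \<le> v; v \<le> b;
        (\<forall>x\<in>{u..v}. \<delta> * \<kappa> \<le> \<psi> x) \<or> (\<forall>x\<in>{u..v}. \<psi> x \<le> - (\<delta> * \<kappa>))\<rbrakk> \<Longrightarrow>
        norm (integral {u..v} (\<lambda>x. cis (\<phi> x))) \<le> B"
  shows "norm (integral {a..b} (\<lambda>x. cis (\<phi> x))) \<le> 2 * B + 2 * \<delta>"
proof -
  have grow: "\<kappa> * (y - x) \<le> \<psi> y - \<psi> x" if "x \<in> {a..b}" "y \<in> {a..b}" "x \<le> y" for x y
  proof (cases "x = y")
    case False
    then have "\<exists>z\<in>{x<..<y}. \<psi> y - \<psi> x = (y - x) * \<psi>' z"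
      using that
      by (intro mvt_simple[of x y \<psi> "\<lambda>z h. h * \<psi>' z"])
        (auto intro!: has_derivative_subset[OF d[unfolded has_field_derivative_def, unfolded mult.commute[of "\<psi>' _"]]])
    then obtain z where "z \<in> {x<..<y}" "\<psi> y - \<psi> x = (y - x) * \<psi>' z" by blast
    then show ?thesis using lb[of z] that by (simp add: mult.commute mult_left_mono)
  qed simp
  have cont\<psi>: "continuous_on {a..b} \<psi>"
    using d by (meson continuous_on_eq_continuous_within DERIV_continuous)
  \<comment> \<open>\<open>c\<close> is a zero of \<open>\<psi>\<close> if there is one, otherwise
    the endpoint where \<open>\<bar>\<psi>\<bar>\<close> is smallest. The two sign conditions are
    vacuous on a side of \<open>c\<close> that contains no points.\<close>
  obtain c where c: "c \<in> {a..b}" "\<And>x. x \<in> {a..b} \<Longrightarrow> c < x \<Longrightarrow> 0 \<le> \<psi> c" "\<And>x. x \<in> {a..b} \<Longrightarrow> x < c \<Longrightarrow> \<psi> c \<le> 0"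
  proof (cases "0 \<le> \<psi> a")
    case True
    then show ?thesis using that[of a] ab by force
  next
    case False
    show ?thesis
    proof (cases "\<psi> b \<le> 0")
      case True
      then show ?thesis using that[of b] ab by force
    next
      case False
      then obtain c where "a \<le> c" "c \<le> b" "\<psi> c = 0"
        using IVT'[of \<psi> a 0 b] ab cont\<psi> \<open>\<not> 0 \<le> \<psi> a\<close> by auto
      then show ?thesis using that[of c] by simp
    qed
  qed
  \<comment> \<open>The window is cut off at the ends of the interval. If it reaches an end, the
    outer piece is a single point and its integral vanishes.\<close>
  define u where "u = max a (c - \<delta>)"
  define v where "v = min b (c + \<delta>)"
  have uv: "a \<le> u" "u \<le> v" "v \<le> b" "v - u \<le> 2 * \<delta>"
    using c(1) ab pos by (auto simp: u_def v_def)
  have int: "(\<lambda>x. cis (\<phi> x)) integrable_on {s..t}" if "a \<le> s" "t \<le> b" for s t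
    by (rule integrable_continuous_real)
      (use that in \<open>auto intro!: continuous_intros intro: continuous_on_subset[OF cont]\<close>)
  have left: "norm (integral {a..u} (\<lambda>x. cis (\<phi> x))) \<le> B"
  proof (cases "a < u")
    case True
    have "\<psi> x \<le> - (\<delta> * \<kappa>)" if "x \<in> {a..u}" for x
    proof -
      have x: "x \<le> c - \<delta>" "x \<in> {a..b}" "x < c" using that True c(1) pos by (auto simp: u_def)
      have "\<kappa> * \<delta> \<le> \<kappa> * (c - x)" using x pos by simp
      then show ?thesis using grow[of x c] c(1) c(3)[of x] x by (simp add: mult.commute)
    qed
    then show ?thesis using uv by (intro B) auto
  qed (use pos uv in simp)
  have right: "norm (integral {v..b} (\<lambda>x. cis (\<phi> x))) \<le> B"
  proof (cases "v < b")
    case True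
    have "\<delta> * \<kappa> \<le> \<psi> x" if "x \<in> {v..b}" for x
    proof -
      have x: "c + \<delta> \<le> x" "x \<in> {a..b}" "c < x" using that True c(1) pos by (auto simp: v_def min_def split: if_splits)
      have "\<kappa> * \<delta> \<le> \<kappa> * (x - c)" using x pos by simp
      then show ?thesis using grow[of c x] c(1) c(2)[of x] x by (simp add: mult.commute)
    qed
    then show ?thesis using uv by (intro B) auto
  qed (use pos uv in simp)
  have mid: "norm (integral {u..v} (\<lambda>x. cis (\<phi> x))) \<le> 2 * \<delta>"
    using norm_integral_cis_le_length[OF uv(2), of \<phi>] uv continuous_on_subset[OF cont, of "{u..v}"] by auto
  have comb: "integral {a..u} (\<lambda>x. cis (\<phi> x)) + integral {u..b} (\<lambda>x. cis (\<phi> x)) = integral {a..b} (\<lambda>x. cis (\<phi> x))"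
    "integral {u..v} (\<lambda>x. cis (\<phi> x)) + integral {v..b} (\<lambda>x. cis (\<phi> x)) = integral {u..b} (\<lambda>x. cis (\<phi> x))"
    using uv by (intro Henstock_Kurzweil_Integration.integral_combine int; simp)+
  have "integral {a..b} (\<lambda>x. cis (\<phi> x)) =
      integral {a..u} (\<lambda>x. cis (\<phi> x)) + integral {u..v} (\<lambda>x. cis (\<phi> x)) + integral {v..b} (\<lambda>x. cis (\<phi> x))"
    by (simp only: comb[symmetric] add.assoc)
  also have "norm \<dots> \<le> B + 2 * \<delta> + B"
    by (intro norm_triangle_le add_mono left mid right)
  finally show ?thesis by simp
qed

text \<open>\<open>\<Phi>\<close> is the tower of derivatives of the phase \<open>\<Phi> 0\<close>.
  Where \<open>\<Phi> r\<close> is large the induction hypothesis applies, up to negating the tower;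
  \<open>van_der_corput_split\<close> with \<open>\<psi> = \<Phi> r\<close> discards the rest. The
  induction starts at 2 because a lower bound on the first derivative alone does not suffice; at 2
  the positivity of \<open>\<Phi> 2\<close> makes \<open>\<Phi> 1\<close> monotone.\<close>

lemma van_der_corput_positive:
  assumes "2 \<le> r"
  shows "\<exists>C\<ge>0. \<forall>\<Phi> a b \<kappa>. a \<le> b \<longrightarrow> 0 < \<kappa> \<longrightarrow>
    (\<forall>j<r. \<forall>x\<in>{a..b}. (\<Phi> j has_real_derivative \<Phi> (Suc j) x) (at x within {a..b})) \<longrightarrow>
    (\<forall>x\<in>{a..b}. \<kappa> \<le> \<Phi> r x) \<longrightarrow>
    norm (integral {a..b} (\<lambda>x. cis (\<Phi> 0 x))) \<le> C * \<kappa> powr (- 1 / real r)"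
  using assms
proof (induction r rule: dec_induct)
  case base
  show ?case
  proof (intro exI[of _ 8] conjI allI impI)
    fix \<Phi> :: "nat \<Rightarrow> real \<Rightarrow> real" and a b \<kappa> :: real
    assume ab: "a \<le> b" and \<kappa>: "0 < \<kappa>"
      and ch: "\<forall>j<2. \<forall>x\<in>{a..b}. (\<Phi> j has_real_derivative \<Phi> (Suc j) x) (at x within {a..b})"
      and lb: "\<forall>x\<in>{a..b}. \<kappa> \<le> \<Phi> 2 x"
    \<comment> \<open>This width balances the two costs:
      \<open>1 / (\<delta> * \<kappa>) = \<delta>\<close>, hence the constant 2 * 3 + 2 = 8.\<close>
    define \<delta> where "\<delta> = \<kappa> powr (- 1 / 2)"
    have \<delta>: "0 < \<delta>" using \<kappa> by (simp add: \<delta>_def)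
    have \<delta>\<kappa>: "1 / (\<delta> * \<kappa>) = \<delta>"
      using \<kappa> powr_add[of \<kappa> "-1/2" "-1/2"] by (simp add: \<delta>_def powr_minus field_simps)
    have d0: "(\<Phi> 0 has_real_derivative \<Phi> 1 x) (at x within S)"
      and d1: "(\<Phi> 1 has_real_derivative \<Phi> 2 x) (at x within S)" if "x \<in> {a..b}" "S \<subseteq> {a..b}" for x S
      using ch[rule_format, of 0 x] ch[rule_format, of 1 x] that
      by (auto intro: DERIV_subset simp: numeral_2_eq_2)
    have cont: "continuous_on {a..b} (\<Phi> 0)"
      using d0 by (meson continuous_on_eq_continuous_within DERIV_continuous order_refl)
    have "norm (integral {a..b} (\<lambda>x. cis (\<Phi> 0 x))) \<le> 2 * (3 / (\<delta> * \<kappa>)) + 2 * \<delta>"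
    proof (rule van_der_corput_split[OF ab cont \<delta> \<kappa> _ d1])
      fix u v assume uv: "a \<le> u" "u \<le> v" "v \<le> b"
        "(\<forall>x\<in>{u..v}. \<delta> * \<kappa> \<le> \<Phi> 1 x) \<or> (\<forall>x\<in>{u..v}. \<Phi> 1 x \<le> - (\<delta> * \<kappa>))"
      have s: "x \<in> {a..b}" "{u..v} \<subseteq> {a..b}" if "x \<in> {u..v}" for x using that uv by auto
      show "norm (integral {u..v} (\<lambda>x. cis (\<Phi> 0 x))) \<le> 3 / (\<delta> * \<kappa>)"
      proof (rule van_der_corput_first_monotone[OF uv(2) _ d0[OF s] d1[OF s] _ uv(4)])
        show "0 \<le> \<Phi> 2 x" if "x \<in> {u..v}" for x
          using bspec[OF lb s(1)[OF that]] \<kappa> by linarith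
      qed (use \<delta> \<kappa> in auto)
    qed (use lb \<delta> \<kappa> in auto)
    also have "\<dots> = 8 * \<kappa> powr (- 1 / real 2)"
      using \<delta>\<kappa> by (simp add: \<delta>_def field_simps)
    finally show "norm (integral {a..b} (\<lambda>x. cis (\<Phi> 0 x))) \<le> 8 * \<kappa> powr (- 1 / real 2)" .
  qed simp
next
  case (step r)
  then obtain C where C: "C \<ge> 0" and IH: "\<And>\<Phi> a b \<kappa>. a \<le> b \<Longrightarrow> 0 < \<kappa> \<Longrightarrow>
    (\<forall>j<r. \<forall>x\<in>{a..b}. (\<Phi> j has_real_derivative \<Phi> (Suc j) x) (at x within {a..b})) \<Longrightarrow>
    (\<forall>x\<in>{a..b}. \<kappa> \<le> \<Phi> r x) \<Longrightarrow>
    norm (integral {a..b} (\<lambda>x. cis (\<Phi> 0 x))) \<le> C * \<kappa> powr (- 1 / real r)"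
    by blast
  show ?case
  proof (intro exI[of _ "2 * C + 2"] conjI allI impI)
    fix \<Phi> :: "nat \<Rightarrow> real \<Rightarrow> real" and a b \<kappa> :: real
    assume ab: "a \<le> b" and \<kappa>: "0 < \<kappa>"
      and ch: "\<forall>j<Suc r. \<forall>x\<in>{a..b}. (\<Phi> j has_real_derivative \<Phi> (Suc j) x) (at x within {a..b})"
      and lb: "\<forall>x\<in>{a..b}. \<kappa> \<le> \<Phi> (Suc r) x"
    \<comment> \<open>Chosen so that the bound \<open>(\<delta> * \<kappa>) powr (- 1 / r)\<close>
      of the induction hypothesis equals the window width \<open>\<delta>\<close>.\<close>
    define \<delta> where "\<delta> = \<kappa> powr (- 1 / real (Suc r))"
    have \<delta>: "0 < \<delta>" using \<kappa> by (simp add: \<delta>_def)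
    have r: "0 < r" using step by simp
    have "\<delta> * \<kappa> = \<kappa> powr (- 1 / real (Suc r) + 1)" unfolding \<delta>_def powr_add using \<kappa> by simp
    also have "- 1 / real (Suc r) + 1 = real r / real (Suc r)" by (simp add: field_simps)
    finally have \<delta>\<kappa>: "(\<delta> * \<kappa>) powr (- 1 / real r) = \<delta>"
      using r by (simp add: \<delta>_def powr_powr)
    have cont: "continuous_on {a..b} (\<Phi> 0)"
      using ch[rule_format, of 0] by (meson continuous_on_eq_continuous_within DERIV_continuous zero_less_Suc)
    have "norm (integral {a..b} (\<lambda>x. cis (\<Phi> 0 x))) \<le> 2 * (C * (\<delta> * \<kappa>) powr (- 1 / real r)) + 2 * \<delta>"
    proof (rule van_der_corput_split[OF ab cont \<delta> \<kappa>])
      fix u v assume uv: "a \<le> u" "u \<le> v" "v \<le> b"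
        and alt: "(\<forall>x\<in>{u..v}. \<delta> * \<kappa> \<le> \<Phi> r x) \<or> (\<forall>x\<in>{u..v}. \<Phi> r x \<le> - (\<delta> * \<kappa>))"
      have s: "{u..v} \<subseteq> {a..b}" using uv by auto
      have ch': "\<forall>j<r. \<forall>x\<in>{u..v}. (\<Phi> j has_real_derivative \<Phi> (Suc j) x) (at x within {u..v})"
        using ch s by (meson DERIV_subset less_SucI subsetD)
      from alt show "norm (integral {u..v} (\<lambda>x. cis (\<Phi> 0 x))) \<le> C * (\<delta> * \<kappa>) powr (- 1 / real r)"
      proof
        assume "\<forall>x\<in>{u..v}. \<Phi> r x \<le> - (\<delta> * \<kappa>)"
        then have "norm (integral {u..v} (\<lambda>x. cis ((\<lambda>j x. - \<Phi> j x) 0 x))) \<le> C * (\<delta> * \<kappa>) powr (- 1 / real r)"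
          using uv \<delta> \<kappa> ch' by (intro IH) (auto intro!: DERIV_minus)
        then show ?thesis
          using norm_integral_cis_minus[OF continuous_on_subset[OF cont s]] by simp
      qed (use uv \<delta> \<kappa> ch' in \<open>intro IH; simp\<close>)
    next
      show "(\<Phi> r has_real_derivative \<Phi> (Suc r) x) (at x within {a..b})" if "x \<in> {a..b}" for x
        using ch that by blast
    qed (use lb C in auto)
    then show "norm (integral {a..b} (\<lambda>x. cis (\<Phi> 0 x))) \<le> (2 * C + 2) * \<kappa> powr (- 1 / real (Suc r))"
      unfolding \<delta>\<kappa> by (simp add: \<delta>_def algebra_simps)
  qed (use C in simp)
qed

text \<open>A continuous top derivative that stays away from 0 has a constant sign, and negating the
  tower only conjugates the integral. \<open>C\<close> is fixed before the phase and the interval,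
  which gives the uniformity needed later.\<close>

theorem van_der_corput:
  assumes "2 \<le> r"
  obtains C where "0 \<le> C" and "\<And>\<Phi> a b \<kappa>. \<lbrakk>a \<le> b; 0 < \<kappa>;
    \<And>j x. j < r \<Longrightarrow> x \<in> {a..b} \<Longrightarrow> (\<Phi> j has_real_derivative \<Phi> (Suc j) x) (at x within {a..b});
    continuous_on {a..b} (\<Phi> r); \<And>x. x \<in> {a..b} \<Longrightarrow> \<kappa> \<le> \<bar>\<Phi> r x\<bar>\<rbrakk> \<Longrightarrow>
    norm (integral {a..b} (\<lambda>x. cis (\<Phi> 0 x))) \<le> C * \<kappa> powr (- 1 / real r)"
proof -
  obtain C where C: "C \<ge> 0" and vdc: "\<And>\<Phi> a b \<kappa>. a \<le> b \<Longrightarrow> 0 < \<kappa> \<Longrightarrow>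
    (\<forall>j<r. \<forall>x\<in>{a..b}. (\<Phi> j has_real_derivative \<Phi> (Suc j) x) (at x within {a..b})) \<Longrightarrow>
    (\<forall>x\<in>{a..b}. \<kappa> \<le> \<Phi> r x) \<Longrightarrow>
    norm (integral {a..b} (\<lambda>x. cis (\<Phi> 0 x))) \<le> C * \<kappa> powr (- 1 / real r)"
    using van_der_corput_positive[OF assms] by blast
  show thesis
  proof (rule that[OF C])
    fix \<Phi> :: "nat \<Rightarrow> real \<Rightarrow> real" and a b \<kappa> :: real
    assume ab: "a \<le> b" and \<kappa>: "0 < \<kappa>"
      and ch: "\<And>j x. j < r \<Longrightarrow> x \<in> {a..b} \<Longrightarrow> (\<Phi> j has_real_derivative \<Phi> (Suc j) x) (at x within {a..b})"
      and cont: "continuous_on {a..b} (\<Phi> r)" and lb: "\<And>x. x \<in> {a..b} \<Longrightarrow> \<kappa> \<le> \<bar>\<Phi> r x\<bar>"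
    have "connected (\<Phi> r ` {a..b})" by (intro connected_continuous_image cont) auto
    moreover have "0 \<notin> \<Phi> r ` {a..b}" using lb \<kappa> by force
    ultimately have "\<not> (\<exists>x\<in>{a..b}. \<exists>y\<in>{a..b}. \<Phi> r x < 0 \<and> 0 < \<Phi> r y)"
      unfolding connected_iff_interval by (meson image_eqI less_imp_le)
    then have "(\<forall>x\<in>{a..b}. \<kappa> \<le> \<Phi> r x) \<or> (\<forall>x\<in>{a..b}. \<kappa> \<le> - \<Phi> r x)"
      using lb \<kappa> by (smt (verit))
    then show "norm (integral {a..b} (\<lambda>x. cis (\<Phi> 0 x))) \<le> C * \<kappa> powr (- 1 / real r)"
    proof
      assume "\<forall>x\<in>{a..b}. \<kappa> \<le> - \<Phi> r x"
      then have "norm (integral {a..b} (\<lambda>x. cis ((\<lambda>j x. - \<Phi> j x) 0 x))) \<le> C * \<kappa> powr (- 1 / real r)"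
        using ab \<kappa> ch by (intro vdc) (auto intro!: DERIV_minus)
      moreover have "continuous_on {a..b} (\<Phi> 0)"
        using ch[of 0] assms by (intro DERIV_continuous_on) auto
      ultimately show ?thesis by (simp add: norm_integral_cis_minus)
    qed (use ab \<kappa> ch in \<open>intro vdc; simp\<close>)
  qed
qed

section \<open>Oscillatory integrals with polynomial phase\<close>

lemma pochhammer_Suc_le_fact: "\<bar>pochhammer (real (Suc i)) m\<bar> \<le> fact (i + m)"
proof -
  have "fact (i + m) = fact i * pochhammer (real (Suc i)) m"
    using pochhammer_product'[of "1::real" i m] by (simp add: pochhammer_fact[symmetric] add.commute)
  moreover have "0 \<le> pochhammer (real (Suc i)) m" by (intro pochhammer_nonneg) simp
  moreover have "(1::real) \<le> fact i" by (rule fact_ge_1)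
  ultimately show ?thesis by (simp add: mult_le_cancel_right1)
qed

text \<open>The factor \<open>\<eta> ^ (e - d)\<close> beats the growth of
  \<open>x ^ (e - d)\<close> on \<open>[-M, M]\<close>: every term of the d-th derivative other than
  the constant one carries at least one factor \<open>\<eta> * M\<close>. So this derivative is
  nearly the constant \<open>fact d * coeff P d\<close>, while the next one is at most a multiple of
  \<open>c\<close>.\<close>

lemma higher_pderiv_tail:
  fixes P :: "real poly"
  assumes deg: "degree P \<le> D" and M: "1 \<le> M" and \<eta>: "0 \<le> \<eta>" "\<eta> * M \<le> 1" and x: "\<bar>x\<bar> \<le> M"
    and c: "0 \<le> c" and tail: "\<And>e. d < e \<Longrightarrow> \<bar>coeff P e\<bar> \<le> \<eta> ^ (e - d) * c"
  shows "\<bar>poly ((pderiv ^^ d) P) x - fact d * coeff P d\<bar> \<le> real D * fact D * (\<eta> * M) * c"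
    and "\<bar>poly ((pderiv ^^ Suc d) P) x\<bar> \<le> real (Suc D) * fact D * c"
proof -
  have exp: "poly ((pderiv ^^ m) P) x = (\<Sum>i\<le>D. pochhammer (real (Suc i)) m * coeff P (i + m) * x ^ i)" for m
  proof -
    have "poly ((pderiv ^^ m) P) x = (\<Sum>i\<le>D. coeff ((pderiv ^^ m) P) i * x ^ i)"
      unfolding poly_altdef using deg
      by (intro sum.mono_neutral_left) (auto simp: degree_higher_pderiv coeff_eq_0)
    then show ?thesis by (simp add: coeff_higher_pderiv)
  qed
  have xi: "\<bar>x\<bar> ^ i \<le> M ^ i" for i using x by (intro power_mono) auto
  have fac: "\<bar>pochhammer (real (Suc i)) m * coeff P (i + m) * x ^ i\<bar> \<le> fact D * (\<bar>coeff P (i + m)\<bar> * M ^ i)" for i m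
  proof (cases "i + m \<le> D")
    case True
    have "\<bar>pochhammer (real (Suc i)) m\<bar> \<le> fact D"
      using pochhammer_Suc_le_fact[of i m] fact_mono[OF True, where 'a = real] by linarith
    then show ?thesis unfolding abs_mult power_abs mult.assoc
      by (intro mult_mono mult_nonneg_nonneg xi) auto
  next
    case False
    then have "coeff P (i + m) = 0" using deg by (intro coeff_eq_0) auto
    then show ?thesis using M by simp
  qed
  have \<eta>1: "\<eta> \<le> 1" using M \<eta> mult_left_mono[of 1 M \<eta>] by simp
  have "\<bar>poly ((pderiv ^^ d) P) x - fact d * coeff P d\<bar> =
     \<bar>\<Sum>i\<in>{..D} - {0}. pochhammer (real (Suc i)) d * coeff P (i + d) * x ^ i\<bar>"
    unfolding exp by (subst sum.remove[of _ 0]) (auto simp: pochhammer_fact)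
  also have "\<dots> \<le> (\<Sum>i\<in>{..D} - {0}. fact D * ((\<eta> * M) * c))"
  proof (intro order.trans[OF sum_abs] sum_mono order.trans[OF fac] mult_left_mono)
    fix i assume "i \<in> {..D} - {0}"
    then have i: "i > 0" by simp
    have "\<bar>coeff P (i + d)\<bar> * M ^ i \<le> (\<eta> ^ i * c) * M ^ i"
      using tail[of "i + d"] i M by (intro mult_right_mono) auto
    also have "\<dots> = (\<eta> * M) ^ i * c" by (simp add: power_mult_distrib)
    also have "\<dots> \<le> (\<eta> * M) ^ 1 * c"
      using \<eta> M c i by (intro mult_right_mono power_decreasing) auto
    finally show "\<bar>coeff P (i + d)\<bar> * M ^ i \<le> \<eta> * M * c" by simp
  qed simp
  finally show "\<bar>poly ((pderiv ^^ d) P) x - fact d * coeff P d\<bar> \<le> real D * fact D * (\<eta> * M) * c"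
    by (simp add: mult.assoc)
  have "\<bar>poly ((pderiv ^^ Suc d) P) x\<bar> \<le> (\<Sum>i\<le>D. fact D * c)"
    unfolding exp
  proof (intro order.trans[OF sum_abs] sum_mono order.trans[OF fac] mult_left_mono)
    fix i
    have "\<bar>coeff P (i + Suc d)\<bar> * M ^ i \<le> (\<eta> ^ Suc i * c) * M ^ i"
      using tail[of "i + Suc d"] M by (intro mult_right_mono) auto
    also have "\<dots> = (\<eta> * (\<eta> * M) ^ i) * c" by (simp add: power_mult_distrib)
    also have "\<dots> \<le> (1 * 1) * c"
      using \<eta> M c \<eta>1 by (intro mult_right_mono mult_mono power_le_one) auto
    finally show "\<bar>coeff P (i + Suc d)\<bar> * M ^ i \<le> c" by simp
  qed simp
  then show "\<bar>poly ((pderiv ^^ Suc d) P) x\<bar> \<le> real (Suc D) * fact D * c"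
    by (simp add: mult.assoc)
qed

lemma poly_higher_pderiv_DERIV:
  "((\<lambda>x. poly ((pderiv ^^ j) P) x) has_real_derivative poly ((pderiv ^^ Suc j) P) x) (at x within S)"
  by (auto intro: poly_DERIV DERIV_subset)

text \<open>The case \<open>d = 1\<close> is not covered by \<open>van_der_corput\<close>: there \<open>\<phi>'\<close> need not be monotone, and one uses
  instead that \<open>\<phi>''\<close> is at most a multiple of \<open>\<phi>'\<close>.\<close>

lemma oscillatory_poly_dominant:
  assumes "1 \<le> d" and M: "1 \<le> M" and \<eta>: "0 \<le> \<eta>" "\<eta> * M * (2 * real D * fact D) \<le> 1" "\<eta> * M \<le> 1"
  shows "\<exists>C\<ge>0. \<forall>P a b c. degree P \<le> D \<longrightarrow> - M \<le> a \<longrightarrow> a \<le> b \<longrightarrow> b \<le> M \<longrightarrow> 0 < c \<longrightarrow>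
     \<bar>coeff P d\<bar> = c \<longrightarrow> (\<forall>e>d. \<bar>coeff P e\<bar> \<le> \<eta> ^ (e - d) * c) \<longrightarrow>
     norm (integral {a..b} (\<lambda>x. cis (poly P x))) \<le> C * (c / 2) powr (- 1 / real d)"
proof -
  \<comment> \<open>The smallness of \<open>\<eta> * M\<close> makes the tail at most
    \<open>c / 2\<close>, against a main term of size \<open>fact d * c\<close>, which is at least
    \<open>c\<close>.\<close>
  have lower: "c / 2 \<le> \<bar>poly ((pderiv ^^ d) P) x\<bar>"
    if "degree P \<le> D" "\<bar>x\<bar> \<le> M" "0 < c" "\<bar>coeff P d\<bar> = c" "\<forall>e>d. \<bar>coeff P e\<bar> \<le> \<eta> ^ (e - d) * c"
    for P :: "real poly" and x c
  proof -
    have "\<bar>poly ((pderiv ^^ d) P) x - fact d * coeff P d\<bar> \<le> real D * fact D * (\<eta> * M) * c"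
      using that M \<eta> by (intro higher_pderiv_tail(1)) auto
    also have "\<dots> = (\<eta> * M * (2 * real D * fact D)) * (c / 2)" by simp
    also have "\<dots> \<le> 1 * (c / 2)" using \<eta> that by (intro mult_right_mono) auto
    finally have "\<bar>poly ((pderiv ^^ d) P) x - fact d * coeff P d\<bar> \<le> c / 2" by simp
    moreover have "1 * c \<le> fact d * \<bar>coeff P d\<bar>" using that by (intro mult_mono) auto
    moreover have "\<bar>fact d * coeff P d\<bar> = fact d * \<bar>coeff P d\<bar>" by (simp add: abs_mult)
    ultimately show ?thesis by linarith
  qed
  show ?thesis
  proof (cases "d = 1")
    case False
    then have "2 \<le> d" using assms(1) by simp
    then obtain C where C: "0 \<le> C" and vdc: "\<And>\<Phi> a b \<kappa>. \<lbrakk>a \<le> b; 0 < \<kappa>;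
      \<And>j x. j < d \<Longrightarrow> x \<in> {a..b} \<Longrightarrow> (\<Phi> j has_real_derivative \<Phi> (Suc j) x) (at x within {a..b});
      continuous_on {a..b} (\<Phi> d); \<And>x. x \<in> {a..b} \<Longrightarrow> \<kappa> \<le> \<bar>\<Phi> d x\<bar>\<rbrakk> \<Longrightarrow>
      norm (integral {a..b} (\<lambda>x. cis (\<Phi> 0 x))) \<le> C * \<kappa> powr (- 1 / real d)"
      using van_der_corput by blast
    show ?thesis
    proof (intro exI[of _ C] conjI C allI impI)
      fix P :: "real poly" and a b c
      assume *: "degree P \<le> D" "- M \<le> a" "a \<le> b" "b \<le> M" "0 < c" "\<bar>coeff P d\<bar> = c"
        "\<forall>e>d. \<bar>coeff P e\<bar> \<le> \<eta> ^ (e - d) * c"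
      have "norm (integral {a..b} (\<lambda>x. cis ((\<lambda>j x. poly ((pderiv ^^ j) P) x) 0 x))) \<le> C * (c / 2) powr (- 1 / real d)"
        using * by (intro vdc poly_higher_pderiv_DERIV continuous_intros lower) auto
      then show "norm (integral {a..b} (\<lambda>x. cis (poly P x))) \<le> C * (c / 2) powr (- 1 / real d)"
        by simp
    qed
  next
    case True
    \<comment> \<open>\<open>K * c\<close> bounds the second derivative. With the first derivative
      at least \<open>c / 2\<close>, the integrand in \<open>van_der_corput_first\<close> is at most
      the constant \<open>4 * K / c\<close>, integrated over a length of at most
      \<open>2 * M\<close>.\<close>
    define K where "K = real (Suc D) * fact D"
    have K: "K \<ge> 0" by (simp add: K_def)
    show ?thesis
    proof (intro exI[of _ "2 + 4 * K * M"] conjI allI impI)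
      fix P :: "real poly" and a b c
      assume *: "degree P \<le> D" "- M \<le> a" "a \<le> b" "b \<le> M" "0 < c" "\<bar>coeff P d\<bar> = c"
        "\<forall>e>d. \<bar>coeff P e\<bar> \<le> \<eta> ^ (e - d) * c"
      have "norm (integral {a..b} (\<lambda>x. cis (poly P x))) \<le> 2 / (c / 2) + (b - a) * (4 * K / c)"
      proof (rule van_der_corput_first)
        show "(poly P has_real_derivative poly (pderiv P) x) (at x within {a..b})"
          "(poly (pderiv P) has_real_derivative poly (pderiv (pderiv P)) x) (at x within {a..b})" for x
          by (auto intro: poly_DERIV DERIV_subset)
        show lb: "c / 2 \<le> \<bar>poly (pderiv P) x\<bar>" if "x \<in> {a..b}" for x
          using lower[of P x c] * that True by auto
        show "((\<lambda>_. 4 * K / c) has_integral (b - a) * (4 * K / c)) {a..b}"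
          using has_integral_const_real[of "4 * K / c" a b] * by simp
        show "\<bar>poly (pderiv (pderiv P)) x\<bar> / (poly (pderiv P) x)\<^sup>2 \<le> 4 * K / c" if "x \<in> {a..b}" for x
        proof -
          have "\<bar>poly (pderiv (pderiv P)) x\<bar> \<le> K * c"
            using higher_pderiv_tail(2)[of P D M \<eta> x c 1] * that True M \<eta> by (auto simp: K_def)
          moreover have "(c / 2)\<^sup>2 \<le> (poly (pderiv P) x)\<^sup>2"
            using lb[OF that] * by (metis abs_le_square_iff abs_of_nonneg divide_nonneg_nonneg less_imp_le zero_le_numeral)
          ultimately have "\<bar>poly (pderiv (pderiv P)) x\<bar> / (poly (pderiv P) x)\<^sup>2 \<le> (K * c) / (c / 2)\<^sup>2"
            using * K by (intro frac_le) auto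
          also have "\<dots> = 4 * K / c" using * by (simp add: power2_eq_square field_simps)
          finally show ?thesis .
        qed
      qed (use * in auto)
      also have "\<dots> \<le> 2 / (c / 2) + (2 * M) * (4 * K / c)"
        using * K by (intro add_left_mono mult_right_mono) auto
      also have "\<dots> = (2 + 4 * K * M) * (c / 2) powr (- 1 / real d)"
        using * True by (simp add: powr_minus field_simps)
      finally show "norm (integral {a..b} (\<lambda>x. cis (poly P x))) \<le> (2 + 4 * K * M) * (c / 2) powr (- 1 / real d)" .
    qed (use K M in simp)
  qed
qed

text \<open>A large coefficient alone is no lower bound for any derivative, since higher
  coefficients may cancel it. The remedy is to pass to the last index \<open>d\<close> at which the
  coefficient is at least \<open>\<eta> ^ d\<close> times the largest non-constant one: it dominates
  everything above it, and it is smaller than the given coefficient by at most the fixed factor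
  \<open>\<eta> ^ D\<close>.\<close>

theorem oscillatory_poly:
  assumes D: "1 \<le> D" and M: "1 \<le> M"
  obtains C where "0 \<le> C" and "\<And>P a b \<kappa> d. \<lbrakk>degree P \<le> D; - M \<le> a; a \<le> b; b \<le> M; 0 < \<kappa>;
     1 \<le> d; d \<le> D; \<kappa> \<le> \<bar>coeff P d\<bar>\<rbrakk> \<Longrightarrow>
     norm (integral {a..b} (\<lambda>x. cis (poly P x))) \<le> C * \<kappa> powr (- 1 / real D)"
proof -
  define \<eta> where "\<eta> = 1 / (M * (2 * real D * fact D))"
  have "1 * 1 \<le> real D * fact D" using D by (intro mult_mono) auto
  then have F: "1 \<le> 2 * real D * fact D" by simp
  have \<eta>0: "0 < \<eta>" using M D by (auto simp: \<eta>_def intro!: mult_pos_pos)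
  have \<eta>M: "\<eta> * M * (2 * real D * fact D) \<le> 1" "\<eta> * M = 1 / (2 * real D * fact D)"
    using M F D by (auto simp: \<eta>_def)
  have \<eta>M1: "\<eta> * M \<le> 1" unfolding \<eta>M(2) using F by (subst divide_le_eq_1_pos) linarith+
  have \<eta>1: "\<eta> \<le> 1" using mult_left_mono[OF M less_imp_le[OF \<eta>0]] \<eta>M1 by linarith
  have "\<exists>C. \<forall>d. 1 \<le> d \<longrightarrow> 0 \<le> C d \<and> (\<forall>P a b c. degree P \<le> D \<longrightarrow> - M \<le> a \<longrightarrow> a \<le> b \<longrightarrow> b \<le> M \<longrightarrow> 0 < c \<longrightarrow>
     \<bar>coeff P d\<bar> = c \<longrightarrow> (\<forall>e>d. \<bar>coeff P e\<bar> \<le> \<eta> ^ (e - d) * c) \<longrightarrow>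
     norm (integral {a..b} (\<lambda>x. cis (poly P x))) \<le> C d * (c / 2) powr (- 1 / real d))"
    using oscillatory_poly_dominant[OF _ M less_imp_le[OF \<eta>0] \<eta>M(1) \<eta>M1] by (intro choice) blast
  then obtain C where C0: "\<And>d. 1 \<le> d \<Longrightarrow> 0 \<le> C d"
    and C: "\<And>d P a b c. \<lbrakk>1 \<le> d; degree P \<le> D; - M \<le> a; a \<le> b; b \<le> M; 0 < c;
     \<bar>coeff P d\<bar> = c; \<And>e. d < e \<Longrightarrow> \<bar>coeff P e\<bar> \<le> \<eta> ^ (e - d) * c\<rbrakk> \<Longrightarrow>
     norm (integral {a..b} (\<lambda>x. cis (poly P x))) \<le> C d * (c / 2) powr (- 1 / real d)"
    by blast
  \<comment> \<open>The summand \<open>2 * M\<close> lets \<open>C'\<close> absorb the trivial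
    estimate by the length of the interval.\<close>
  define C' where "C' = (\<Sum>d\<in>{1..D}. C d) + 2 * M"
  have C'0: "0 \<le> C'" using C0 M by (auto simp: C'_def intro!: add_nonneg_nonneg sum_nonneg)
  have CC': "C d \<le> C'" if "1 \<le> d" "d \<le> D" for d
    using member_le_sum[of d "{1..D}" C] that C0 M by (auto simp: C'_def)
  have MC': "2 * M \<le> C'" using C0 by (auto simp: C'_def intro!: sum_nonneg)
  show thesis
  proof (rule that[of "C' * (\<eta> ^ D / 2) powr (- 1 / real D)"])
    show "0 \<le> C' * (\<eta> ^ D / 2) powr (- 1 / real D)" using C'0 by simp
    fix P :: "real poly" and a b \<kappa> d0
    assume *: "degree P \<le> D" "- M \<le> a" "a \<le> b" "b \<le> M" "0 < \<kappa>"
      "1 \<le> d0" "d0 \<le> D" "\<kappa> \<le> \<bar>coeff P d0\<bar>"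
    define L where "L = Max ((\<lambda>e. \<bar>coeff P e\<bar>) ` {1..D})"
    have Lmem: "L \<in> (\<lambda>e. \<bar>coeff P e\<bar>) ` {1..D}" unfolding L_def using D by (intro Max_in) auto
    have Lge: "\<bar>coeff P e\<bar> \<le> L" if "e \<in> {1..D}" for e unfolding L_def using that by (intro Max_ge) auto
    have L\<kappa>: "\<kappa> \<le> L" using * Lge[of d0] by simp
    \<comment> \<open>An index attaining the maximum \<open>L\<close> belongs to \<open>S\<close>.
      For \<open>e\<close> beyond the last element \<open>d\<close>, failure to lie in
      \<open>S\<close> reads
      \<open>\<bar>coeff P e\<bar> < \<eta> ^ (e - d) * (\<eta> ^ d * L)\<close>, which is the decay
      required of the tail.\<close>
    define S where "S = {e \<in> {1..D}. \<eta> ^ e * L \<le> \<bar>coeff P e\<bar>}"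
    have "S \<noteq> {}"
    proof -
      obtain e where e: "e \<in> {1..D}" "L = \<bar>coeff P e\<bar>" using Lmem by blast
      have "\<eta> ^ e * L \<le> 1 * L" using \<eta>0 \<eta>1 L\<kappa> * by (intro mult_right_mono power_le_one) auto
      then show ?thesis using e by (auto simp: S_def)
    qed
    define d where "d = Max S"
    have finS: "finite S" by (simp add: S_def)
    have dS: "d \<in> S" unfolding d_def using finS \<open>S \<noteq> {}\<close> by (intro Max_in)
    then have d: "1 \<le> d" "d \<le> D" "\<eta> ^ d * L \<le> \<bar>coeff P d\<bar>" by (auto simp: S_def)
    define c where "c = \<bar>coeff P d\<bar>"
    have "\<eta> ^ D * \<kappa> \<le> \<eta> ^ d * L"
      using \<eta>0 \<eta>1 d L\<kappa> * by (intro mult_mono power_decreasing) auto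
    then have c: "\<eta> ^ D * \<kappa> \<le> c" using d by (simp add: c_def)
    have pos: "0 < \<eta> ^ D * \<kappa>" using \<eta>0 * by simp
    have tail: "\<bar>coeff P e\<bar> \<le> \<eta> ^ (e - d) * c" if "d < e" for e
    proof (cases "e \<le> D")
      case True
      then have "e \<notin> S" using Max_ge[OF finS, of e] that by (auto simp: d_def)
      then have "\<bar>coeff P e\<bar> \<le> \<eta> ^ e * L" using True that d by (auto simp: S_def)
      also have "\<dots> = \<eta> ^ (e - d) * (\<eta> ^ d * L)" using that by (simp add: mult.assoc[symmetric] power_add[symmetric])
      also have "\<dots> \<le> \<eta> ^ (e - d) * c" using d \<eta>0 by (intro mult_left_mono) (auto simp: c_def)
      finally show ?thesis .
    next
      case False
      then have "coeff P e = 0" using * by (intro coeff_eq_0) auto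
      then show ?thesis using \<eta>0 by (simp add: c_def)
    qed
    have "norm (integral {a..b} (\<lambda>x. cis (poly P x))) \<le> C' * (c / 2) powr (- 1 / real D)"
    \<comment> \<open>The exponent \<open>1 / d\<close> varies with the polynomial. For
      \<open>c / 2 \<ge> 1\<close> it may be weakened to \<open>1 / D\<close>; for smaller
      \<open>c\<close> the trivial bound is already good enough.\<close>
    proof (cases "1 \<le> c / 2")
      case True
      have "norm (integral {a..b} (\<lambda>x. cis (poly P x))) \<le> C d * (c / 2) powr (- 1 / real d)"
        using * d pos c by (intro C tail) (auto simp: c_def)
      also have "\<dots> \<le> C' * (c / 2) powr (- 1 / real D)"
        using True d C'0 by (intro mult_mono CC' powr_mono) (auto simp: field_simps)
      finally show ?thesis .
    next
      case False
      have "norm (integral {a..b} (\<lambda>x. cis (poly P x))) \<le> b - a"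
        using * by (intro norm_integral_cis_le_length continuous_intros) auto
      also have "\<dots> \<le> C' * 1" using * MC' by simp
      also have "1 \<le> (c / 2) powr (- 1 / real D)"
        using False pos c D powr_mono2'[of "- 1 / real D" "c / 2" 1] by auto
      finally show ?thesis using C'0 by (simp add: mult_left_mono)
    qed
    also have "\<dots> \<le> C' * (\<eta> ^ D / 2 * \<kappa>) powr (- 1 / real D)"
      using c pos C'0 \<eta>0 * powr_mono2'[of "- 1 / real D" "\<eta> ^ D / 2 * \<kappa>" "c / 2"] by (intro mult_left_mono) auto
    also have "\<dots> = C' * (\<eta> ^ D / 2) powr (- 1 / real D) * \<kappa> powr (- 1 / real D)"
      using \<eta>0 * by (subst powr_mult) auto
    finally show "norm (integral {a..b} (\<lambda>x. cis (poly P x))) \<le> C' * (\<eta> ^ D / 2) powr (- 1 / real D) * \<kappa> powr (- 1 / real D)" .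
  qed
qed

section \<open>Mean square bounds and almost everywhere convergence\<close>

lemma sum_symmetric_square:
  fixes I :: "nat \<Rightarrow> nat \<Rightarrow> real"
  assumes "\<And>m n. I n m = I m n"
  shows "(\<Sum>n\<in>{1..N}. \<Sum>m\<in>{1..N}. I n m) = (\<Sum>n\<in>{1..N}. I n n) + 2 * (\<Sum>n\<in>{1..N}. \<Sum>m\<in>{1..<n}. I n m)"
proof (induction N)
  case (Suc N)
  have "{1..<Suc N} = {1..N}" by auto
  moreover have "(\<Sum>n\<in>{1..N}. I n (Suc N)) = (\<Sum>m\<in>{1..N}. I (Suc N) m)"
    by (intro sum.cong refl assms)
  ultimately show ?case using Suc by (simp add: sum.distrib)
qed simp

lemma norm_sum_cis_squared:
  "(norm (\<Sum>n\<in>A. cis (\<phi> n)))\<^sup>2 = (\<Sum>n\<in>A. \<Sum>m\<in>A. Re (cis (\<phi> n - \<phi> m)))"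
proof -
  have "complex_of_real ((norm (\<Sum>n\<in>A. cis (\<phi> n)))\<^sup>2) = (\<Sum>n\<in>A. cis (\<phi> n)) * cnj (\<Sum>n\<in>A. cis (\<phi> n))"
    by (rule complex_norm_square)
  also have "\<dots> = (\<Sum>n\<in>A. \<Sum>m\<in>A. cis (\<phi> n - \<phi> m))"
    by (simp add: sum_product cis_cnj cis_mult)
  finally have "Re (complex_of_real ((norm (\<Sum>n\<in>A. cis (\<phi> n)))\<^sup>2)) = Re (\<Sum>n\<in>A. \<Sum>m\<in>A. cis (\<phi> n - \<phi> m))"
    by (rule arg_cong)
  then show ?thesis by simp
qed

text \<open>Expanding the square gives the diagonal, of size \<open>(b - a) * N\<close>, and twice
  the pairs \<open>m < n\<close>. For each \<open>n\<close> at most \<open>n0\<close> of these have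
  \<open>m < n0\<close>; they are estimated trivially, which produces the term
  \<open>2 * real n0\<close>.\<close>

lemma mean_square_exponential_sum:
  fixes \<phi> :: "nat \<Rightarrow> real \<Rightarrow> real" and K :: "nat \<Rightarrow> nat \<Rightarrow> real"
  assumes ab: "a \<le> b" and cont: "\<And>n. continuous_on {a..b} (\<phi> n)"
    and C: "0 \<le> C" and K: "\<And>n m. 0 \<le> K n m"
    and bound: "\<And>m n. \<lbrakk>n0 \<le> m; m < n\<rbrakk> \<Longrightarrow>
      norm (integral {a..b} (\<lambda>x. cis (\<phi> n x - \<phi> m x))) \<le> C * K n m"
  shows "integral {a..b} (\<lambda>x. (norm (\<Sum>n\<in>{1..N}. cis (\<phi> n x)))\<^sup>2)
     \<le> (b - a) * (1 + 2 * real n0) * real N + 2 * C * (\<Sum>n\<in>{1..N}. \<Sum>m\<in>{1..<n}. K n m)"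
proof -
  let ?c = "\<lambda>n m x. cis (\<phi> n x - \<phi> m x)"
  define I where "I n m = norm (integral {a..b} (?c n m))" for n m
  have int: "?c n m integrable_on {a..b}" for n m
    using cont by (intro integrable_continuous_real continuous_intros) auto
  have len: "I n m \<le> b - a" for n m
    unfolding I_def by (intro norm_integral_cis_le_length ab continuous_intros cont)
  have sym: "I n m = I m n" for n m
  proof -
    have "cnj (integral {a..b} (?c m n)) = integral {a..b} (?c n m)"
      unfolding integral_cnj by (simp add: cis_cnj)
    then show ?thesis unfolding I_def by (metis complex_mod_cnj)
  qed
  have "integral {a..b} (\<lambda>x. (norm (\<Sum>n\<in>{1..N}. cis (\<phi> n x)))\<^sup>2) =
      (\<Sum>n\<in>{1..N}. \<Sum>m\<in>{1..N}. Re (integral {a..b} (?c n m)))"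
    unfolding norm_sum_cis_squared
  proof (intro integral_unique has_integral_sum finite_atLeastAtMost)
    show "((\<lambda>x. Re (?c n m x)) has_integral Re (integral {a..b} (?c n m))) {a..b}" for n m
      by (intro has_integral_Re integrable_integral int)
  qed
  also have "\<dots> \<le> (\<Sum>n\<in>{1..N}. \<Sum>m\<in>{1..N}. I n m)"
    unfolding I_def by (intro sum_mono complex_Re_le_cmod)
  also have "\<dots> = (\<Sum>n\<in>{1..N}. I n n) + 2 * (\<Sum>n\<in>{1..N}. \<Sum>m\<in>{1..<n}. I n m)"
    by (rule sum_symmetric_square[OF sym])
  also have "\<dots> \<le> (\<Sum>n\<in>{1..N}. b - a) +
      2 * (\<Sum>n\<in>{1..N}. C * (\<Sum>m\<in>{1..<n}. K n m) + real n0 * (b - a))"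
  proof (intro add_mono mult_left_mono sum_mono len)
    fix n
    have "(\<Sum>m\<in>{1..<n}. I n m) \<le> (\<Sum>m\<in>{1..<n}. C * K n m + (if m < n0 then b - a else 0))"
    proof (intro sum_mono)
      fix m assume m: "m \<in> {1..<n}"
      show "I n m \<le> C * K n m + (if m < n0 then b - a else 0)"
        using len[of n m] bound[of m n] m mult_nonneg_nonneg[OF C K[of n m]] ab by (auto simp: I_def)
    qed
    also have "\<dots> = C * (\<Sum>m\<in>{1..<n}. K n m) + (\<Sum>m\<in>{1..<n}. if m < n0 then b - a else 0)"
      by (simp add: sum.distrib sum_distrib_left)
    also have "(\<Sum>m\<in>{1..<n}. if m < n0 then b - a else 0) = (\<Sum>m\<in>{1..<n} \<inter> {..<n0}. b - a)"
      by (subst sum.inter_restrict) auto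
    also have "\<dots> \<le> (\<Sum>m<n0. b - a)"
      using ab by (intro sum_mono2) auto
    finally show "(\<Sum>m\<in>{1..<n}. I n m) \<le> C * (\<Sum>m\<in>{1..<n}. K n m) + real n0 * (b - a)" by simp
  qed simp
  also have "\<dots> = (b - a) * (1 + 2 * real n0) * real N + 2 * C * (\<Sum>n\<in>{1..N}. \<Sum>m\<in>{1..<n}. K n m)"
    by (simp only: sum.distrib sum_distrib_left[symmetric]) (simp add: algebra_simps)
  finally show ?thesis .
qed

text \<open>Along \<open>N\<^sub>j = \<lfloor>exp (j powr s)\<rfloor>\<close> with \<open>1 / (1 + \<epsilon>) < s < 1\<close> the bounds \<open>(ln N\<^sub>j) powr -(1 + \<epsilon>)\<close> are summable
  while \<open>N\<^sub>j\<^sub>+\<^sub>1 / N\<^sub>j\<close> tends to \<open>1\<close>.\<close>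

lemma subexponential_subsequence:
  fixes \<epsilon> :: real
  assumes "0 < \<epsilon>"
  obtains M :: "nat \<Rightarrow> nat" where "mono M" "\<And>j. 1 \<le> M j" "filterlim M at_top sequentially"
    "(\<lambda>j. real (M (Suc j)) / real (M j)) \<longlonglongrightarrow> 1"
    "summable (\<lambda>j. 1 / ln (real (M j)) powr (1 + \<epsilon>))"
proof -
  define s where "s = 1 / (1 + \<epsilon> / 2)"
  have s: "0 < s" "s < 1" using assms by (auto simp: s_def)
  define M where "M j = nat \<lfloor>exp (real j powr s)\<rfloor>" for j :: nat
  have M1: "1 \<le> M j" for j
  proof -
    have "1 \<le> exp (real j powr s)" by simp
    then have "1 \<le> \<lfloor>exp (real j powr s)\<rfloor>" by (simp only: one_le_floor)
    then show ?thesis unfolding M_def by linarith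
  qed
  show thesis
  proof (rule that)
    show "mono M"
      unfolding M_def using s by (intro monoI nat_mono floor_mono) (auto intro: powr_mono2)
    show "1 \<le> M j" for j by (rule M1)
    show "filterlim M at_top sequentially"
      unfolding M_def using s by real_asymp
    show "(\<lambda>j. real (M (Suc j)) / real (M j)) \<longlonglongrightarrow> 1"
      unfolding M_def using s by real_asymp
    show "summable (\<lambda>j. 1 / ln (real (M j)) powr (1 + \<epsilon>))"
    proof (rule summable_comparison_test_bigo)
      have "- (s * (1 + \<epsilon>)) < - 1" using assms by (simp add: s_def field_simps)
      then show "summable (\<lambda>j. norm (real j powr (- (s * (1 + \<epsilon>)))))"
        by (simp add: summable_real_powr_iff)
      show "(\<lambda>j. 1 / ln (real (M j)) powr (1 + \<epsilon>)) \<in> O(\<lambda>j. real j powr (- (s * (1 + \<epsilon>))))"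
        unfolding M_def using s assms by real_asymp
    qed
  qed
qed

text \<open>For \<open>M j \<le> N < M (Suc j)\<close> the sum up to \<open>N\<close> differs from
  the one up to \<open>M j\<close> by fewer than \<open>M (Suc j) - M j\<close> terms of modulus at
  most 1, a vanishing proportion of \<open>M j\<close>.\<close>

lemma averages_tendsto_along_subsequence:
  fixes z :: "nat \<Rightarrow> complex" and M :: "nat \<Rightarrow> nat"
  assumes z: "\<And>n. norm (z n) \<le> 1" and M: "mono M" "\<And>j. 1 \<le> M j" "filterlim M at_top sequentially"
    and ratio: "(\<lambda>j. real (M (Suc j)) / real (M j)) \<longlonglongrightarrow> 1"
    and sub: "(\<lambda>j. (\<Sum>n\<in>{1..M j}. z n) / of_nat (M j)) \<longlonglongrightarrow> 0"
  shows "(\<lambda>N. (\<Sum>n\<in>{1..N}. z n) / of_nat N) \<longlonglongrightarrow> 0"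
proof (rule LIMSEQ_I)
  fix e :: real assume e: "0 < e"
  have "\<forall>\<^sub>F j in sequentially. norm ((\<Sum>n\<in>{1..M j}. z n) / of_nat (M j)) < e / 2 \<and>
     real (M (Suc j)) / real (M j) < 1 + e / 2"
    using tendstoD[OF sub, of "e / 2"] order_tendstoD(2)[OF ratio, of "1 + e / 2"] e
    by (auto intro: eventually_conj)
  then obtain j0 where j0: "\<And>j. j0 \<le> j \<Longrightarrow> norm ((\<Sum>n\<in>{1..M j}. z n) / of_nat (M j)) < e / 2"
    "\<And>j. j0 \<le> j \<Longrightarrow> real (M (Suc j)) / real (M j) < 1 + e / 2"
    unfolding eventually_sequentially by blast
  have "norm ((\<Sum>n\<in>{1..N}. z n) / of_nat N - 0) < e" if N: "M j0 \<le> N" for N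
  proof -
    have "\<forall>\<^sub>F j in sequentially. Suc N \<le> M j" using M(3) unfolding filterlim_at_top by blast
    then obtain J where "Suc N \<le> M J" unfolding eventually_sequentially by blast
    then have J: "N < M J" by simp
    define j where "j = (GREATEST j. M j \<le> N)"
    have bd: "i \<le> J" if "M i \<le> N" for i using J that monoD[OF M(1), of J i] by (cases "i \<le> J") auto
    have j: "M j \<le> N" unfolding j_def using N bd by (rule GreatestI_nat)
    have "j0 \<le> j" unfolding j_def using N bd by (rule Greatest_le_nat)
    have "N < M (Suc j)"
      using Greatest_le_nat[of "\<lambda>j. M j \<le> N" "Suc j" J] bd unfolding j_def[symmetric] by force
    let ?m = "M j"
    have m: "0 < real ?m" using M(2)[of j] by simp
    have "{1..N} = {1..?m} \<union> {?m<..N}" using j by auto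
    then have "(\<Sum>n\<in>{1..N}. z n) = (\<Sum>n\<in>{1..?m}. z n) + (\<Sum>n\<in>{?m<..N}. z n)"
      by (simp only:) (rule sum.union_disjoint; auto)
    also have "norm \<dots> \<le> norm (\<Sum>n\<in>{1..?m}. z n) + real (N - ?m)"
    proof -
      have "norm (\<Sum>n\<in>{?m<..N}. z n) \<le> (\<Sum>n\<in>{?m<..N}. 1)"
        by (rule sum_norm_le) (rule z)
      then show ?thesis using norm_triangle_ineq[of "\<Sum>n\<in>{1..?m}. z n" "\<Sum>n\<in>{?m<..N}. z n"] by simp
    qed
    also have "real (N - ?m) \<le> real (M (Suc j)) - real ?m" using \<open>N < M (Suc j)\<close> j by simp
    finally have le: "norm (\<Sum>n\<in>{1..N}. z n) \<le> norm (\<Sum>n\<in>{1..?m}. z n) + (real (M (Suc j)) - real ?m)"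
      by simp
    have "norm (\<Sum>n\<in>{1..N}. z n) / real N \<le> (norm (\<Sum>n\<in>{1..?m}. z n) + (real (M (Suc j)) - real ?m)) / real ?m"
      using j m by (intro frac_le le order.trans[OF norm_ge_zero le]) auto
    also have "\<dots> = norm ((\<Sum>n\<in>{1..?m}. z n) / of_nat ?m) + (real (M (Suc j)) / real ?m - 1)"
      using m by (simp add: norm_divide field_simps)
    also have "\<dots> < e" using j0[OF \<open>j0 \<le> j\<close>] by linarith
    finally show ?thesis by (simp add: norm_divide)
  qed
  then show "\<exists>N0. \<forall>N\<ge>N0. norm ((\<Sum>n\<in>{1..N}. z n) / of_nat N - 0) < e" by blast
qed

text \<open>By monotone convergence the sum of the \<open>f j\<close> has a finite integral, so it
  is finite almost everywhere and its terms tend to 0 there.\<close>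

lemma AE_tendsto_zero_of_summable_integrals:
  fixes f :: "nat \<Rightarrow> real \<Rightarrow> real"
  assumes cont: "\<And>j. continuous_on {a..b} (f j)" and nonneg: "\<And>j x. 0 \<le> f j x"
    and sum: "summable (\<lambda>j. integral {a..b} (f j))"
  shows "AE x in lebesgue. x \<in> {a..b} \<longrightarrow> (\<lambda>j. f j x) \<longlonglongrightarrow> 0"
proof -
  let ?g = "\<lambda>j x. ennreal (f j x) * indicator {a..b} x"
  have meas: "?g j \<in> borel_measurable lborel" for j
  proof -
    have "(\<lambda>x. indicator {a..b} x *\<^sub>R f j x) \<in> borel_measurable borel"
      by (intro borel_measurable_continuous_on_indicator cont) auto
    then have "(\<lambda>x. ennreal (indicator {a..b} x *\<^sub>R f j x)) \<in> borel_measurable lborel" by simp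
    also have "(\<lambda>x. ennreal (indicator {a..b} x *\<^sub>R f j x)) = ?g j"
      by (auto simp: fun_eq_iff indicator_def)
    finally show ?thesis .
  qed
  have int: "integral\<^sup>N lborel (?g j) = ennreal (integral {a..b} (f j))" for j
    by (intro nn_integral_has_integral_lebesgue' integrable_integral integrable_continuous_real cont nonneg)
  have "(\<integral>\<^sup>+x. (\<Sum>j. ?g j x) \<partial>lborel) = (\<Sum>j. ennreal (integral {a..b} (f j)))"
    by (subst nn_integral_suminf) (use meas int in auto)
  also have "\<dots> \<noteq> \<infinity>"
    using sum nonneg by (subst suminf_ennreal2) (auto intro!: Henstock_Kurzweil_Integration.integral_nonneg
      integrable_continuous_real cont)
  finally have "AE x in lborel. (\<Sum>j. ?g j x) \<noteq> \<infinity>"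
    by (intro nn_integral_PInf_AE borel_measurable_suminf_order meas)
  then have "AE x in lborel. x \<in> {a..b} \<longrightarrow> (\<lambda>j. f j x) \<longlonglongrightarrow> 0"
  proof eventually_elim
    case (elim x)
    show ?case
    proof
      assume "x \<in> {a..b}"
      then have "(\<Sum>j. ennreal (f j x)) \<noteq> top" using elim by simp
      then have "summable (\<lambda>j. f j x)" using nonneg by (intro summable_suminf_not_top) auto
      then show "(\<lambda>j. f j x) \<longlonglongrightarrow> 0" by (rule summable_LIMSEQ_zero)
    qed
  qed
  then show ?thesis by (rule AE_completion)
qed

text \<open>Second moments of order \<open>1 / ln N powr (1 + \<epsilon>)\<close> are not summable
  over all N, only along the sparse sequence \<open>M\<close>; the gaps are then filled
  deterministically. The diagonal and the early pairs give \<open>B / N\<close>, which is eventually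
  below this bound as well.\<close>

theorem metric_exponential_sums:
  fixes \<phi> :: "nat \<Rightarrow> real \<Rightarrow> real" and K :: "nat \<Rightarrow> nat \<Rightarrow> real"
  assumes ab: "a \<le> b" and cont: "\<And>n. continuous_on {a..b} (\<phi> n)"
    and C: "0 \<le> C" and K: "\<And>n m. 0 \<le> K n m" and \<epsilon>: "0 < \<epsilon>"
    and kernel: "\<forall>\<^sub>F N in sequentially. 1 / (real N)\<^sup>2 * (\<Sum>n\<in>{1..N}. \<Sum>m\<in>{1..<n}. K n m)
       \<le> 1 / ln (real N) powr (1 + \<epsilon>)"
    and bound: "\<And>m n. \<lbrakk>n0 \<le> m; m < n\<rbrakk> \<Longrightarrow>
      norm (integral {a..b} (\<lambda>x. cis (\<phi> n x - \<phi> m x))) \<le> C * K n m"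
  shows "AE x in lebesgue. x \<in> {a..b} \<longrightarrow> (\<lambda>N. (\<Sum>n\<in>{1..N}. cis (\<phi> n x)) / of_nat N) \<longlonglongrightarrow> 0"
proof -
  obtain M :: "nat \<Rightarrow> nat" where M: "mono M" "\<And>j. 1 \<le> M j" "filterlim M at_top sequentially"
    "(\<lambda>j. real (M (Suc j)) / real (M j)) \<longlonglongrightarrow> 1"
    "summable (\<lambda>j. 1 / ln (real (M j)) powr (1 + \<epsilon>))"
    using subexponential_subsequence[OF \<epsilon>] by blast
  define F where "F N x = (norm ((\<Sum>n\<in>{1..N}. cis (\<phi> n x)) / of_nat N))\<^sup>2" for N x
  define B where "B = (b - a) * (1 + 2 * real n0)"
  have F_cont: "continuous_on {a..b} (F N)" for N
    unfolding F_def by (cases "N = 0") (auto intro!: continuous_intros cont)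
  have F_nonneg: "0 \<le> F N x" for N x by (simp add: F_def)
  have F_int: "integral {a..b} (F N) \<le> B / real N +
      2 * C * (1 / (real N)\<^sup>2 * (\<Sum>n\<in>{1..N}. \<Sum>m\<in>{1..<n}. K n m))" if "0 < N" for N
  proof -
    have "F N = (\<lambda>x. 1 / (real N)\<^sup>2 * (norm (\<Sum>n\<in>{1..N}. cis (\<phi> n x)))\<^sup>2)"
      by (simp add: F_def fun_eq_iff norm_divide power_divide)
    then have "integral {a..b} (F N) = 1 / (real N)\<^sup>2 * integral {a..b} (\<lambda>x. (norm (\<Sum>n\<in>{1..N}. cis (\<phi> n x)))\<^sup>2)"
      by (simp add: integral_mult_right)
    also have "\<dots> \<le> 1 / (real N)\<^sup>2 * (B * real N + 2 * C * (\<Sum>n\<in>{1..N}. \<Sum>m\<in>{1..<n}. K n m))"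
      unfolding B_def by (intro mult_left_mono mean_square_exponential_sum[OF ab cont C K bound]) auto
    also have "\<dots> = B / real N + 2 * C * (1 / (real N)\<^sup>2 * (\<Sum>n\<in>{1..N}. \<Sum>m\<in>{1..<n}. K n m))"
      using that by (simp add: power2_eq_square field_simps)
    finally show ?thesis .
  qed
  have "(\<lambda>N. B / real N * ln (real N) powr (1 + \<epsilon>)) \<longlonglongrightarrow> 0"
    using \<epsilon> by real_asymp
  then have "\<forall>\<^sub>F N in sequentially. B / real N * ln (real N) powr (1 + \<epsilon>) < 1"
    by (rule order_tendstoD) simp
  with kernel eventually_gt_at_top[of 1]
  have "\<forall>\<^sub>F N in sequentially. integral {a..b} (F N) \<le> (1 + 2 * C) * (1 / ln (real N) powr (1 + \<epsilon>))"
  proof eventually_elim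
    case (elim N)
    have "B / real N \<le> 1 / ln (real N) powr (1 + \<epsilon>)"
      using elim by (subst pos_le_divide_eq) auto
    moreover have "2 * C * (1 / (real N)\<^sup>2 * (\<Sum>n\<in>{1..N}. \<Sum>m\<in>{1..<n}. K n m)) \<le> 2 * C * (1 / ln (real N) powr (1 + \<epsilon>))"
      using elim C by (intro mult_left_mono) auto
    ultimately show ?case
      using F_int[of N] elim unfolding distrib_right by linarith
  qed
  from eventually_compose_filterlim[OF this M(3)]
  have "\<forall>\<^sub>F j in sequentially. norm (integral {a..b} (F (M j))) \<le> (1 + 2 * C) * (1 / ln (real (M j)) powr (1 + \<epsilon>))"
  proof eventually_elim
    case (elim j)
    have "0 \<le> integral {a..b} (F (M j))"
      by (intro Henstock_Kurzweil_Integration.integral_nonneg integrable_continuous_real F_cont F_nonneg)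
    then show ?case using elim by simp
  qed
  then have "summable (\<lambda>j. integral {a..b} (F (M j)))"
    by (rule summable_comparison_test_ev) (intro summable_mult M(5))
  then have "AE x in lebesgue. x \<in> {a..b} \<longrightarrow> (\<lambda>j. F (M j) x) \<longlonglongrightarrow> 0"
    by (intro AE_tendsto_zero_of_summable_integrals F_cont F_nonneg)
  then show ?thesis
  proof eventually_elim
    case (elim x)
    show ?case
    proof
      assume "x \<in> {a..b}"
      then have "(\<lambda>j. sqrt (F (M j) x)) \<longlonglongrightarrow> sqrt 0" using elim by (intro tendsto_real_sqrt) blast
      then have "(\<lambda>j. (\<Sum>n\<in>{1..M j}. cis (\<phi> n x)) / of_nat (M j)) \<longlonglongrightarrow> 0"
        by (simp add: F_def tendsto_norm_zero_iff)
      then show "(\<lambda>N. (\<Sum>n\<in>{1..N}. cis (\<phi> n x)) / of_nat N) \<longlonglongrightarrow> 0"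
        by (intro averages_tendsto_along_subsequence[OF _ M(1-4)]) auto
    qed
  qed
qed

section \<open>Real analytic functions and derivatives of real powers\<close>

lemma real_analytic_const: "real_analytic (\<lambda>_. c)"
  unfolding real_analytic_def using has_fps_expansion_const by blast

lemma real_analytic_add:
  "real_analytic f \<Longrightarrow> real_analytic g \<Longrightarrow> real_analytic (\<lambda>x. f x + g x)"
  unfolding real_analytic_def using has_fps_expansion_add by blast

lemma real_analytic_mult:
  "real_analytic f \<Longrightarrow> real_analytic g \<Longrightarrow> real_analytic (\<lambda>x. f x * g x)"
  unfolding real_analytic_def using has_fps_expansion_mult by blast

lemma real_analytic_deriv:
  assumes "real_analytic f" shows "real_analytic (deriv f)"
  unfolding real_analytic_def
proof
  fix x
  obtain F where "(\<lambda>h. f (x + h)) has_fps_expansion F" using assms unfolding real_analytic_def by blast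
  then have "deriv (\<lambda>h. f (x + h)) has_fps_expansion fps_deriv F" by (rule has_fps_expansion_deriv)
  moreover have "deriv (\<lambda>h. f (x + h)) = (\<lambda>h. deriv f (x + h))"
    unfolding deriv_def by (simp add: DERIV_shift[symmetric] add.commute[of x])
  ultimately show "\<exists>F. (\<lambda>h. deriv f (x + h)) has_fps_expansion F" by auto
qed

lemma real_analytic_DERIV:
  assumes "real_analytic f" shows "(f has_real_derivative deriv f x) (at x within S)"
proof -
  obtain F where F: "(\<lambda>h. f (x + h)) has_fps_expansion F" using assms unfolding real_analytic_def by blast
  then have "(eval_fps F has_field_derivative eval_fps (fps_deriv F) 0) (at 0)"
    by (intro has_field_derivative_eval_fps) (simp add: has_fps_expansion_def zero_ereal_def)
  moreover have "\<forall>\<^sub>F h in nhds 0. eval_fps F h = f (x + h)" using F by (simp add: has_fps_expansion_def)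
  ultimately have "((\<lambda>h. f (h + x)) has_field_derivative eval_fps (fps_deriv F) 0) (at 0)"
    by (subst (asm) DERIV_cong_ev[OF refl _ refl]) (auto simp: add.commute)
  then have "(f has_field_derivative eval_fps (fps_deriv F) 0) (at x)"
    using DERIV_shift[of f _ 0 x] by simp
  then show ?thesis by (metis DERIV_imp_deriv has_field_derivative_at_within)
qed

lemma real_analytic_continuous_on: "real_analytic f \<Longrightarrow> continuous_on S f"
  using real_analytic_DERIV by (rule DERIV_continuous_on)

text \<open>A non-zero expansion is a power of h times a series with non-zero constant term; the
  latter stays non-zero near 0 by continuity, and the power vanishes only at 0.\<close>

lemma real_analytic_zero_dichotomy:
  assumes "real_analytic f"
  shows "(\<forall>\<^sub>F y in nhds x. f y = 0) \<or> (\<forall>\<^sub>F y in at x. f y \<noteq> 0)"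
proof -
  obtain F where F: "(\<lambda>h. f (x + h)) has_fps_expansion F" using assms unfolding real_analytic_def by blast
  then have r: "0 < fps_conv_radius F" and ev: "\<forall>\<^sub>F h in nhds 0. eval_fps F h = f (x + h)"
    by (auto simp: has_fps_expansion_def)
  show ?thesis
  proof (cases "F = 0")
    case True
    then have "\<forall>\<^sub>F h in nhds 0. f (x + h) = 0" using ev by (auto elim: eventually_mono)
    then have "\<forall>\<^sub>F y in nhds x. f y = 0"
      using eventually_filtermap[of "\<lambda>y. f y = 0" "\<lambda>h. h + x" "nhds 0"] filtermap_nhds_shift[of "- x" 0]
      by (simp add: add.commute)
    then show ?thesis ..
  next
    case False
    define G where "G = fps_shift (subdegree F) F"
    have G0: "eval_fps G 0 \<noteq> 0" using False by (simp add: G_def eval_fps_at_0)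
    have "isCont (eval_fps G) 0"
      using r by (intro continuous_eval_fps) (simp add: G_def zero_ereal_def)
    then have "\<forall>\<^sub>F h in at 0. eval_fps G h \<noteq> 0"
      using G0 by (simp add: isCont_def tendsto_imp_eventually_ne)
    moreover have "\<forall>\<^sub>F h in at 0. h \<in> eball 0 (fps_conv_radius F)"
      using r by (intro eventually_at_in_open') (auto simp: zero_ereal_def)
    moreover have "\<forall>\<^sub>F h in at 0. eval_fps F h = f (x + h)"
      using ev by (simp add: eventually_at_filter eventually_mono)
    moreover have "\<forall>\<^sub>F h in at 0. h \<noteq> (0::real)" by (simp add: eventually_at_filter)
    ultimately have "\<forall>\<^sub>F h in at 0. f (h + x) \<noteq> 0"
    proof eventually_elim
      case (elim h)
      have "eval_fps G h = eval_fps F h / h ^ subdegree F"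
        using elim unfolding G_def by (subst eval_fps_shift) auto
      then show ?case using elim by (auto simp: add.commute)
    qed
    then show ?thesis
      by (subst at_to_0) (simp add: eventually_filtermap)
  qed
qed

text \<open>The set \<open>Z\<close> of points near which \<open>f\<close> vanishes is open, and the
  dichotomy makes its complement open too; by connectedness it is empty. So zeros do not accumulate,
  each bounded interval contains finitely many, and there are countably many in all.\<close>

lemma real_analytic_zeros_negligible:
  assumes f: "real_analytic f" and "\<exists>x. f x \<noteq> 0"
  shows "negligible {x. f x = 0}"
proof -
  define Z where "Z = {x. \<forall>\<^sub>F y in nhds x. f y = 0}"
  have "open Z"
  proof (subst open_subopen, intro ballI)
    fix x assume "x \<in> Z"
    then obtain T where "open T" "x \<in> T" "\<forall>y\<in>T. f y = 0"
      unfolding Z_def by (auto simp: eventually_nhds)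
    then show "\<exists>T. open T \<and> x \<in> T \<and> T \<subseteq> Z"
      unfolding Z_def by (intro exI[of _ T]) (auto simp: eventually_nhds)
  qed
  moreover have "open (- Z)"
  proof (subst open_subopen, intro ballI)
    fix x assume "x \<in> - Z"
    then have "\<forall>\<^sub>F y in at x. f y \<noteq> 0" using real_analytic_zero_dichotomy[OF f, of x] by (auto simp: Z_def)
    then obtain T where T: "open T" "x \<in> T" "\<forall>y\<in>T. y \<noteq> x \<longrightarrow> f y \<noteq> 0"
      unfolding eventually_at_topological by auto
    have "y \<notin> Z" if "y \<in> T" for y
    proof (cases "y = x")
      case False
      then show ?thesis using T that eventually_nhds_x_imp_x by (fastforce simp: Z_def)
    qed (use \<open>x \<in> - Z\<close> in simp)
    then show "\<exists>T. open T \<and> x \<in> T \<and> T \<subseteq> - Z" using T by blast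
  qed
  ultimately have "Z = {} \<or> Z = UNIV" using clopen[of Z] by (simp add: closed_def)
  moreover have "Z \<noteq> UNIV" using assms(2) eventually_nhds_x_imp_x by (fastforce simp: Z_def)
  ultimately have ne: "\<forall>\<^sub>F y in at x. f y \<noteq> 0" for x
    using real_analytic_zero_dichotomy[OF f, of x] by (auto simp: Z_def)
  have fin: "finite ({x. f x = 0} \<inter> {- real n..real n})" for n
  proof (rule ccontr)
    assume "infinite ({x. f x = 0} \<inter> {- real n..real n})"
    then obtain x where "x islimpt ({x. f x = 0} \<inter> {- real n..real n})"
      using Heine_Borel_imp_Bolzano_Weierstrass[of "{- real n..real n}"] by (metis compact_Icc inf_le2)
    then have "\<exists>\<^sub>F y in at x. f y = 0"
      by (auto simp: islimpt_conv_frequently_at elim!: frequently_elim1)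
    then show False using ne[of x] by (simp add: frequently_def)
  qed
  have "{x. f x = 0} = (\<Union>n. {x. f x = 0} \<inter> {- real n..real n})"
  proof (intro equalityI subsetI)
    fix x assume "x \<in> {x. f x = 0}"
    moreover obtain n where "\<bar>x\<bar> \<le> real n" using real_arch_simple by blast
    ultimately have "x \<in> {x. f x = 0} \<inter> {- real n..real n}" by (simp add: abs_le_iff)
    then show "x \<in> (\<Union>n. {x. f x = 0} \<inter> {- real n..real n})" by blast
  qed auto
  moreover have "negligible (\<Union>n. {x. f x = 0} \<inter> {- real n..real n})"
    using fin by (intro negligible_countable_Union) (auto intro: negligible_finite)
  ultimately show ?thesis by simp
qed

text \<open>The \<open>r\<close>-th derivative of \<open>x \<mapsto> g x powr \<beta>\<close> is \<open>g x powr (\<beta> - r)\<close> times a polynomial in \<open>\<beta>\<close> of degree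
  \<open>r\<close> whose \<open>j\<close>-th coefficient is the following analytic function.\<close>

primrec powr_deriv_coeff :: "(real \<Rightarrow> real) \<Rightarrow> nat \<Rightarrow> nat \<Rightarrow> real \<Rightarrow> real" where
  "powr_deriv_coeff g 0 j = (\<lambda>x. if j = 0 then 1 else 0)"
| "powr_deriv_coeff g (Suc r) j = (\<lambda>x.
     (if j = 0 then 0 else deriv g x * powr_deriv_coeff g r (j - 1) x)
     + (- real r) * (deriv g x * powr_deriv_coeff g r j x) + g x * deriv (powr_deriv_coeff g r j) x)"

definition powr_deriv :: "(real \<Rightarrow> real) \<Rightarrow> nat \<Rightarrow> real \<Rightarrow> real \<Rightarrow> real" where
  "powr_deriv g r \<beta> x = g x powr (\<beta> - real r) * (\<Sum>j\<le>r. powr_deriv_coeff g r j x * \<beta> ^ j)"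

lemma powr_deriv_coeff_analytic:
  assumes "real_analytic g" shows "real_analytic (powr_deriv_coeff g r j)"
proof (induction r arbitrary: j)
  case (Suc r)
  have "real_analytic (\<lambda>x. if j = 0 then 0 else deriv g x * powr_deriv_coeff g r (j - 1) x)"
    by (cases "j = 0") (auto intro!: real_analytic_mult real_analytic_const real_analytic_deriv assms Suc)
  then show ?case
    unfolding powr_deriv_coeff.simps
    by (intro real_analytic_add real_analytic_mult real_analytic_const real_analytic_deriv assms Suc)
qed (cases "j = 0"; auto intro: real_analytic_const)

lemma powr_deriv_coeff_eq_0: "r < j \<Longrightarrow> powr_deriv_coeff g r j = (\<lambda>_. 0)"
  by (induction r arbitrary: j) auto

text \<open>At the top index only the first summand of the recursion survives. This is why the zeros
  of \<open>deriv g\<close> are the points to be avoided.\<close>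

lemma powr_deriv_coeff_leading: "powr_deriv_coeff g r r x = deriv g x ^ r"
  by (induction r) (auto simp: powr_deriv_coeff_eq_0)

lemma powr_deriv_0: "0 < g x \<Longrightarrow> powr_deriv g 0 \<beta> x = g x powr \<beta>"
  by (simp add: powr_deriv_def)

text \<open>Taking \<open>g x powr (\<beta> - r - 1)\<close> out of the product rule leaves
  \<open>(\<beta> - r) * g' * S + g * S'\<close>, where S is the sum in \<open>powr_deriv\<close>.
  Sorting this by powers of \<open>\<beta>\<close> is the recursion of
  \<open>powr_deriv_coeff\<close>; its case \<open>j = 0\<close> accounts for the index shift caused
  by the factor \<open>\<beta>\<close>.\<close>

lemma powr_deriv_DERIV:
  assumes g: "real_analytic g" and pos: "0 < g x"
  shows "(powr_deriv g r \<beta> has_real_derivative powr_deriv g (Suc r) \<beta> x) (at x within S)"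
proof -
  let ?q = "powr_deriv_coeff g r" and ?g' = "deriv g x"
  let ?S = "\<Sum>j\<le>r. ?q j x * \<beta> ^ j" and ?S' = "\<Sum>j\<le>r. deriv (?q j) x * \<beta> ^ j"
  have dg: "(g has_real_derivative ?g') (at x)" by (rule real_analytic_DERIV[OF g])
  have dS: "((\<lambda>x. \<Sum>j\<le>r. ?q j x * \<beta> ^ j) has_real_derivative ?S') (at x)"
    by (intro DERIV_sum DERIV_cmult_right real_analytic_DERIV powr_deriv_coeff_analytic g)
  have dp: "((\<lambda>x. g x powr (\<beta> - real r)) has_real_derivative
      (\<beta> - real r) * g x powr (\<beta> - real r - 1) * ?g') (at x)"
    using DERIV_fun_powr[OF dg pos, of "\<beta> - real r"] by simp
  have top: "?q (Suc r) = (\<lambda>_. 0)" by (simp add: powr_deriv_coeff_eq_0)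
  have "(\<Sum>j\<le>Suc r. powr_deriv_coeff g (Suc r) j x * \<beta> ^ j) =
     (\<Sum>j\<le>Suc r. (if j = 0 then 0 else ?g' * ?q (j - 1) x) * \<beta> ^ j)
     + (- real r) * ?g' * (\<Sum>j\<le>Suc r. ?q j x * \<beta> ^ j) + g x * (\<Sum>j\<le>Suc r. deriv (?q j) x * \<beta> ^ j)"
    unfolding powr_deriv_coeff.simps distrib_right sum.distrib sum_distrib_left mult.assoc by (rule refl)
  also have "(\<Sum>j\<le>Suc r. (if j = 0 then 0 else ?g' * ?q (j - 1) x) * \<beta> ^ j) = ?g' * \<beta> * ?S"
    by (subst sum.atMost_Suc_shift) (simp add: sum_distrib_left mult_ac)
  also have "(\<Sum>j\<le>Suc r. ?q j x * \<beta> ^ j) = ?S" by (simp add: top)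
  also have "(\<Sum>j\<le>Suc r. deriv (?q j) x * \<beta> ^ j) = ?S'" by (simp add: top)
  finally have R: "(\<Sum>j\<le>Suc r. powr_deriv_coeff g (Suc r) j x * \<beta> ^ j) =
     (\<beta> - real r) * ?g' * ?S + g x * ?S'" by (simp add: algebra_simps)
  have e: "g x powr (\<beta> - real r) = g x powr (\<beta> - real r - 1) * g x"
    using pos by (simp add: powr_diff)
  have "((\<lambda>x. g x powr (\<beta> - real r) * (\<Sum>j\<le>r. ?q j x * \<beta> ^ j)) has_real_derivative
      ((\<beta> - real r) * g x powr (\<beta> - real r - 1) * ?g') * ?S + ?S' * g x powr (\<beta> - real r)) (at x)"
    by (rule DERIV_mult'[OF dp dS, THEN DERIV_cong]) simp
  moreover have "((\<beta> - real r) * g x powr (\<beta> - real r - 1) * ?g') * ?S + ?S' * g x powr (\<beta> - real r)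
      = powr_deriv g (Suc r) \<beta> x"
    unfolding powr_deriv_def R e by (simp add: algebra_simps diff_diff_eq)
  ultimately have "(powr_deriv g r \<beta> has_real_derivative powr_deriv g (Suc r) \<beta> x) (at x)"
    by (simp add: powr_deriv_def[abs_def])
  then show ?thesis by (rule has_field_derivative_at_within)
qed

text \<open>Mean value theorem in the exponent at fixed \<open>x\<close>. The derivative
  \<open>f' x \<beta>\<close> is \<open>g x powr (\<beta> - r)\<close> times a polynomial in
  \<open>\<beta>\<close> with leading term \<open>ln (g x) * deriv g x ^ r * \<beta> ^ r\<close>. On
  the compact interval this leading coefficient is bounded away from 0, so for large
  \<open>\<beta>\<close> the polynomial is too.\<close>

lemma powr_deriv_separation:
  assumes g: "real_analytic g" and g1: "\<And>x. 1 < g x" and r: "1 \<le> r" and ab: "a \<le> b"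
    and nz: "\<And>x. x \<in> {a..b} \<Longrightarrow> deriv g x \<noteq> 0"
  obtains c B where "0 < c" and "\<And>x \<beta> \<gamma>. \<lbrakk>x \<in> {a..b}; B \<le> \<beta>; B \<le> \<gamma>\<rbrakk> \<Longrightarrow>
      c * \<bar>\<beta> - \<gamma>\<bar> \<le> \<bar>powr_deriv g r \<beta> x - powr_deriv g r \<gamma> x\<bar>"
proof -
  let ?q = "powr_deriv_coeff g r"
  have gc: "continuous_on {a..b} g" and qc: "continuous_on {a..b} (?q j)" for j
    using g powr_deriv_coeff_analytic by (auto intro: real_analytic_continuous_on)
  have lnc: "continuous_on {a..b} (\<lambda>x. ln (g x))"
  proof (intro continuous_intros gc ballI)
    show "g x \<noteq> 0" for x using g1[of x] by simp
  qed
  have "\<exists>\<kappa>>0. \<forall>x\<in>{a..b}. \<kappa> \<le> \<bar>ln (g x) * ?q r x\<bar>"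
  proof -
    have "continuous_on {a..b} (\<lambda>x. \<bar>ln (g x) * ?q r x\<bar>)" by (intro continuous_intros lnc qc)
    then obtain x0 where x0: "x0 \<in> {a..b}" "\<forall>x\<in>{a..b}. \<bar>ln (g x0) * ?q r x0\<bar> \<le> \<bar>ln (g x) * ?q r x\<bar>"
      using continuous_attains_inf[of "{a..b}" "\<lambda>x. \<bar>ln (g x) * ?q r x\<bar>"] ab by auto
    have "0 < \<bar>ln (g x0) * ?q r x0\<bar>"
      using nz[OF x0(1)] ln_gt_zero[OF g1, of x0] by (simp add: powr_deriv_coeff_leading)
    then show ?thesis using x0(2) by blast
  qed
  then obtain \<kappa> where \<kappa>: "0 < \<kappa>" "\<And>x. x \<in> {a..b} \<Longrightarrow> \<kappa> \<le> \<bar>ln (g x) * ?q r x\<bar>" by blast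
  \<comment> \<open>The absolute coefficients of all terms of degree below \<open>r\<close>: those
    multiplied by \<open>ln g\<close> other than the leading one, and those from differentiating the
    polynomial in \<open>\<beta>\<close>.\<close>
  define lo where "lo x = (\<Sum>j<r. \<bar>ln (g x) * ?q j x\<bar>) + (\<Sum>j\<le>r. real j * \<bar>?q j x\<bar>)" for x
  have "continuous_on {a..b} lo" unfolding lo_def by (intro continuous_intros lnc qc)
  then obtain x1 where "\<forall>x\<in>{a..b}. lo x \<le> lo x1"
    using continuous_attains_sup[of "{a..b}" lo] ab by auto
  then obtain M where M: "\<And>x. x \<in> {a..b} \<Longrightarrow> lo x \<le> M" by blast
  \<comment> \<open>Three demands on \<open>\<beta>\<close>: at least 1, so that lower powers are
    dominated by \<open>\<beta> ^ (r - 1)\<close>; at least \<open>r\<close>, so that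
    \<open>g x powr (\<beta> - r)\<close> is at least 1; at least \<open>2 * M / \<kappa>\<close>,
    so that the lower terms use up at most half of the leading one.\<close>
  define B where "B = max 1 (max (real r) (2 * M / \<kappa>))"
  define f' where "f' x \<beta> = g x powr (\<beta> - real r) * (ln (g x) * (\<Sum>j\<le>r. ?q j x * \<beta> ^ j)
        + (\<Sum>j\<le>r. ?q j x * (real j * \<beta> ^ (j - 1))))" for x \<beta>
  have d: "((\<lambda>\<beta>. powr_deriv g r \<beta> x) has_real_derivative f' x \<beta>) (at \<beta>)" for x \<beta>
  proof -
    have "0 < g x" using g1[of x] by simp
    then have "((\<lambda>\<beta>. g x powr (\<beta> - real r)) has_real_derivative g x powr (\<beta> - real r) * ln (g x)) (at \<beta>)"
      by (auto intro!: derivative_eq_intros)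
    moreover have "((\<lambda>\<beta>. \<Sum>j\<le>r. ?q j x * \<beta> ^ j) has_real_derivative
         (\<Sum>j\<le>r. ?q j x * (real j * \<beta> ^ (j - 1)))) (at \<beta>)"
      by (auto intro!: derivative_eq_intros simp: mult_ac)
    ultimately have "((\<lambda>\<beta>. g x powr (\<beta> - real r) * (\<Sum>j\<le>r. ?q j x * \<beta> ^ j)) has_real_derivative
       g x powr (\<beta> - real r) * ln (g x) * (\<Sum>j\<le>r. ?q j x * \<beta> ^ j) +
       (\<Sum>j\<le>r. ?q j x * (real j * \<beta> ^ (j - 1))) * g x powr (\<beta> - real r)) (at \<beta>)"
      by (rule DERIV_mult)
    then show ?thesis by (simp add: powr_deriv_def[abs_def] f'_def algebra_simps)
  qed
  have lower: "\<kappa> / 2 \<le> \<bar>f' x \<beta>\<bar>" if x: "x \<in> {a..b}" and \<beta>: "B \<le> \<beta>" for x \<beta>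
  proof -
    have \<beta>1: "1 \<le> \<beta>" "real r \<le> \<beta>" "2 * M \<le> \<beta> * \<kappa>"
      using \<beta> \<kappa>(1) by (auto simp: B_def divide_le_eq)
    let ?low = "(\<Sum>j<r. (ln (g x) * ?q j x) * \<beta> ^ j) + (\<Sum>j\<le>r. ?q j x * (real j * \<beta> ^ (j - 1)))"
    have "\<bar>?low\<bar> \<le> (\<Sum>j<r. \<bar>ln (g x) * ?q j x\<bar> * \<beta> ^ (r - 1)) + (\<Sum>j\<le>r. real j * \<bar>?q j x\<bar> * \<beta> ^ (r - 1))"
    proof (intro order.trans[OF abs_triangle_ineq] add_mono order.trans[OF sum_abs] sum_mono)
      fix j assume "j \<in> {..<r}"
      then have "\<beta> ^ j \<le> \<beta> ^ (r - 1)" using \<beta>1 by (intro power_increasing) auto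
      then show "\<bar>ln (g x) * ?q j x * \<beta> ^ j\<bar> \<le> \<bar>ln (g x) * ?q j x\<bar> * \<beta> ^ (r - 1)"
        using \<beta>1 by (subst abs_mult) (auto intro!: mult_left_mono)
    next
      fix j assume "j \<in> {..r}"
      then have "\<beta> ^ (j - 1) \<le> \<beta> ^ (r - 1)" using \<beta>1 by (intro power_increasing) auto
      then have "real j * \<bar>?q j x\<bar> * \<beta> ^ (j - 1) \<le> real j * \<bar>?q j x\<bar> * \<beta> ^ (r - 1)"
        by (intro mult_left_mono) auto
      then show "\<bar>?q j x * (real j * \<beta> ^ (j - 1))\<bar> \<le> real j * \<bar>?q j x\<bar> * \<beta> ^ (r - 1)"
        using \<beta>1 by (simp add: abs_mult mult_ac)
    qed
    also have "\<dots> = lo x * \<beta> ^ (r - 1)" by (simp add: lo_def sum_distrib_right distrib_right)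
    also have "\<dots> \<le> (\<kappa> / 2 * \<beta>) * \<beta> ^ (r - 1)"
      using M[OF x] \<beta>1 by (intro mult_right_mono) (auto simp: mult.commute)
    also have "\<dots> = \<kappa> / 2 * \<beta> ^ r" using r by (cases r) auto
    finally have low: "\<bar>?low\<bar> \<le> \<kappa> / 2 * \<beta> ^ r" .
    have "ln (g x) * (\<Sum>j\<le>r. ?q j x * \<beta> ^ j) + (\<Sum>j\<le>r. ?q j x * (real j * \<beta> ^ (j - 1)))
        = ln (g x) * ?q r x * \<beta> ^ r + ?low"
      by (simp add: lessThan_Suc_atMost[symmetric] sum_distrib_left algebra_simps)
    moreover have "\<kappa> * \<beta> ^ r \<le> \<bar>ln (g x) * ?q r x * \<beta> ^ r\<bar>"
      using \<kappa>(2)[OF x] \<beta>1 by (subst abs_mult) (auto intro!: mult_right_mono)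
    moreover have "\<kappa> / 2 * 1 \<le> \<kappa> / 2 * \<beta> ^ r" using \<kappa> \<beta>1 by (intro mult_left_mono one_le_power) auto
    ultimately have "\<kappa> / 2 \<le> \<bar>ln (g x) * (\<Sum>j\<le>r. ?q j x * \<beta> ^ j) + (\<Sum>j\<le>r. ?q j x * (real j * \<beta> ^ (j - 1)))\<bar>"
      using low by linarith
    moreover have "1 \<le> g x powr (\<beta> - real r)"
      using g1[of x] \<beta>1 by (intro ge_one_powr_ge_zero) auto
    ultimately have "1 * (\<kappa> / 2) \<le> g x powr (\<beta> - real r) *
        \<bar>ln (g x) * (\<Sum>j\<le>r. ?q j x * \<beta> ^ j) + (\<Sum>j\<le>r. ?q j x * (real j * \<beta> ^ (j - 1)))\<bar>"
      using \<kappa>(1) by (intro mult_mono) auto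
    then show ?thesis by (simp add: f'_def abs_mult)
  qed
  show thesis
  proof (rule that[of "\<kappa> / 2" B])
    have main: "\<kappa> / 2 * \<bar>\<beta> - \<gamma>\<bar> \<le> \<bar>powr_deriv g r \<beta> x - powr_deriv g r \<gamma> x\<bar>"
      if x: "x \<in> {a..b}" and "B \<le> \<gamma>" "\<gamma> < \<beta>" for x \<beta> \<gamma>
    proof -
      obtain \<xi> where \<xi>: "\<gamma> < \<xi>" "powr_deriv g r \<beta> x - powr_deriv g r \<gamma> x = (\<beta> - \<gamma>) * f' x \<xi>"
        using MVT2[OF \<open>\<gamma> < \<beta>\<close> d] by blast
      have "\<kappa> / 2 \<le> \<bar>f' x \<xi>\<bar>" using \<xi> that by (intro lower) auto
      then show ?thesis unfolding \<xi>(2) abs_mult by (subst mult.commute) (intro mult_left_mono; simp)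
    qed
    show "\<kappa> / 2 * \<bar>\<beta> - \<gamma>\<bar> \<le> \<bar>powr_deriv g r \<beta> x - powr_deriv g r \<gamma> x\<bar>"
      if "x \<in> {a..b}" "B \<le> \<beta>" "B \<le> \<gamma>" for x \<beta> \<gamma>
      using main[of x \<gamma> \<beta>] main[of x \<beta> \<gamma>] that
      by (cases \<beta> \<gamma> rule: linorder_cases) (auto simp: abs_minus_commute)
  qed (use \<kappa> in simp)
qed

text \<open>The derivative of order \<open>Suc D\<close> does not see \<open>P\<close> at all, so
  \<open>C\<close> and \<open>B\<close> are independent of its coefficients.
  \<open>D \<ge> 1\<close> makes this order at least 2, as \<open>van_der_corput\<close>
  requires.\<close>

theorem oscillatory_powr_plus_poly:
  assumes g: "real_analytic g" and g1: "\<And>x. 1 < g x" and D: "1 \<le> D" and ab: "a \<le> b"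
    and nz: "\<And>x. x \<in> {a..b} \<Longrightarrow> deriv g x \<noteq> 0" and L: "L \<noteq> 0"
  obtains C B where "0 \<le> C" and "\<And>P \<beta> \<gamma>. \<lbrakk>degree P \<le> D; B \<le> \<beta>; B \<le> \<gamma>; \<beta> \<noteq> \<gamma>\<rbrakk> \<Longrightarrow>
     norm (integral {a..b} (\<lambda>x. cis (L * (g x powr \<beta> - g x powr \<gamma>) + poly P x)))
       \<le> C * \<bar>\<beta> - \<gamma>\<bar> powr (- 1 / real (Suc D))"
proof -
  have D': "2 \<le> Suc D" using D by simp
  obtain C where C: "0 \<le> C" and vdc: "\<And>\<Phi> a b \<kappa>. \<lbrakk>a \<le> b; 0 < \<kappa>;
      \<And>j x. j < Suc D \<Longrightarrow> x \<in> {a..b} \<Longrightarrow> (\<Phi> j has_real_derivative \<Phi> (Suc j) x) (at x within {a..b});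
      continuous_on {a..b} (\<Phi> (Suc D)); \<And>x. x \<in> {a..b} \<Longrightarrow> \<kappa> \<le> \<bar>\<Phi> (Suc D) x\<bar>\<rbrakk> \<Longrightarrow>
      norm (integral {a..b} (\<lambda>x. cis (\<Phi> 0 x))) \<le> C * \<kappa> powr (- 1 / real (Suc D))"
    using van_der_corput[OF D'] by blast
  obtain c B where c: "0 < c" and sep: "\<And>x \<beta> \<gamma>. \<lbrakk>x \<in> {a..b}; B \<le> \<beta>; B \<le> \<gamma>\<rbrakk> \<Longrightarrow>
      c * \<bar>\<beta> - \<gamma>\<bar> \<le> \<bar>powr_deriv g (Suc D) \<beta> x - powr_deriv g (Suc D) \<gamma> x\<bar>"
    using powr_deriv_separation[OF g g1 _ ab nz, of "Suc D"] by auto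
  show thesis
  proof (rule that[of "C * (\<bar>L\<bar> * c) powr (- 1 / real (Suc D))" B])
    fix P :: "real poly" and \<beta> \<gamma>
    assume *: "degree P \<le> D" "B \<le> \<beta>" "B \<le> \<gamma>" "\<beta> \<noteq> \<gamma>"
    define \<Phi> where "\<Phi> j x = L * (powr_deriv g j \<beta> x - powr_deriv g j \<gamma> x) + poly ((pderiv ^^ j) P) x" for j x
    have g0: "0 < g x" for x using g1[of x] by simp
    have d: "(\<Phi> j has_real_derivative \<Phi> (Suc j) x) (at x within S)" for j x S
      unfolding \<Phi>_def
      by (intro DERIV_add DERIV_cmult DERIV_diff powr_deriv_DERIV[OF g g0] poly_higher_pderiv_DERIV)
    have "norm (integral {a..b} (\<lambda>x. cis (\<Phi> 0 x))) \<le> C * (\<bar>L\<bar> * c * \<bar>\<beta> - \<gamma>\<bar>) powr (- 1 / real (Suc D))"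
    proof (intro vdc ab d)
      show "0 < \<bar>L\<bar> * c * \<bar>\<beta> - \<gamma>\<bar>" using c L * by simp
      show "continuous_on {a..b} (\<Phi> (Suc D))" by (rule DERIV_continuous_on[OF d])
      have "degree ((pderiv ^^ D) P) = 0" using * by (simp add: degree_higher_pderiv)
      then have "(pderiv ^^ Suc D) P = 0" by (simp add: pderiv_eq_0_iff)
      then have "\<Phi> (Suc D) x = L * (powr_deriv g (Suc D) \<beta> x - powr_deriv g (Suc D) \<gamma> x)" for x
        unfolding \<Phi>_def by (simp only: poly_0 add_0_right)
      then show "\<bar>L\<bar> * c * \<bar>\<beta> - \<gamma>\<bar> \<le> \<bar>\<Phi> (Suc D) x\<bar>" if "x \<in> {a..b}" for x
        using sep[OF that, of \<beta> \<gamma>] * by (simp add: abs_mult mult.assoc mult_left_mono)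
    qed
    also have "\<dots> = C * (\<bar>L\<bar> * c) powr (- 1 / real (Suc D)) * \<bar>\<beta> - \<gamma>\<bar> powr (- 1 / real (Suc D))"
      using c by (subst powr_mult) auto
    finally show "norm (integral {a..b} (\<lambda>x. cis (L * (g x powr \<beta> - g x powr \<gamma>) + poly P x)))
       \<le> C * (\<bar>L\<bar> * c) powr (- 1 / real (Suc D)) * \<bar>\<beta> - \<gamma>\<bar> powr (- 1 / real (Suc D))"
      by (simp add: \<Phi>_def powr_deriv_0[where g = g, OF g0])
  qed (use C in simp)
qed

section \<open>Weyl's criterion\<close>

definition trig_poly :: "(real \<Rightarrow> complex) \<Rightarrow> bool" where
  "trig_poly f \<longleftrightarrow> (\<exists>K c. finite K \<and> f = (\<lambda>t. \<Sum>k\<in>K. c k * cis (2 * pi * (of_int k * t))))"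

lemma trig_poly_const: "trig_poly (\<lambda>t. c)"
  unfolding trig_poly_def by (intro exI[of _ "{0}"] exI[of _ "\<lambda>_. c"]) auto

lemma trig_poly_cmult:
  assumes "trig_poly f" shows "trig_poly (\<lambda>t. c * f t)"
proof -
  obtain K d where "finite K" "f = (\<lambda>t. \<Sum>k\<in>K. d k * cis (2 * pi * (of_int k * t)))"
    using assms unfolding trig_poly_def by blast
  then show ?thesis
    unfolding trig_poly_def
    by (intro exI[of _ K] exI[of _ "\<lambda>k. c * d k"]) (auto simp: sum_distrib_left mult.assoc)
qed

lemma trig_poly_add:
  assumes "trig_poly f" "trig_poly g" shows "trig_poly (\<lambda>t. f t + g t)"
proof -
  obtain K c where K: "finite K" "f = (\<lambda>t. \<Sum>k\<in>K. c k * cis (2 * pi * (of_int k * t)))"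
    using assms unfolding trig_poly_def by blast
  obtain L d where L: "finite L" "g = (\<lambda>t. \<Sum>k\<in>L. d k * cis (2 * pi * (of_int k * t)))"
    using assms unfolding trig_poly_def by blast
  define c' d' where "c' k = (if k \<in> K then c k else 0)" and "d' k = (if k \<in> L then d k else 0)" for k
  have "f = (\<lambda>t. \<Sum>k\<in>K \<union> L. c' k * cis (2 * pi * (of_int k * t)))"
    unfolding K(2) using K(1) L(1)
    by (intro ext sum.mono_neutral_cong_left) (auto simp: c'_def)
  moreover have "g = (\<lambda>t. \<Sum>k\<in>K \<union> L. d' k * cis (2 * pi * (of_int k * t)))"
    unfolding L(2) using K(1) L(1)
    by (intro ext sum.mono_neutral_cong_left) (auto simp: d'_def)
  ultimately have "(\<lambda>t. f t + g t) = (\<lambda>t. \<Sum>k\<in>K \<union> L. (c' k + d' k) * cis (2 * pi * (of_int k * t)))"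
    by (simp add: sum.distrib distrib_right)
  then show ?thesis
    unfolding trig_poly_def
    using K(1) L(1) by (intro exI[of _ "K \<union> L"] exI[of _ "\<lambda>k. c' k + d' k"]) auto
qed

lemma trig_poly_sum:
  assumes "finite I" "\<And>i. i \<in> I \<Longrightarrow> trig_poly (f i)"
  shows "trig_poly (\<lambda>t. \<Sum>i\<in>I. f i t)"
  using assms by (induction I rule: finite_induct) (auto intro: trig_poly_add trig_poly_const)

lemma trig_poly_cis: "trig_poly (\<lambda>t. cis (2 * pi * (of_int k * t)))"
  unfolding trig_poly_def by (intro exI[of _ "{k}"] exI[of _ "\<lambda>_. 1"]) auto

lemma trig_poly_mult:
  assumes "trig_poly f" "trig_poly g" shows "trig_poly (\<lambda>t. f t * g t)"
proof -
  obtain K c where K: "finite K" "f = (\<lambda>t. \<Sum>k\<in>K. c k * cis (2 * pi * (of_int k * t)))"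
    using assms unfolding trig_poly_def by blast
  obtain L d where L: "finite L" "g = (\<lambda>t. \<Sum>k\<in>L. d k * cis (2 * pi * (of_int k * t)))"
    using assms unfolding trig_poly_def by blast
  have "(\<lambda>t. f t * g t) =
      (\<lambda>t. \<Sum>k\<in>K. \<Sum>l\<in>L. (c k * d l) * cis (2 * pi * (of_int (k + l) * t)))"
    unfolding K(2) L(2) sum_product
    by (intro ext sum.cong refl) (simp add: cis_mult[symmetric] algebra_simps)
  then show ?thesis
    using K(1) L(1)
    by (simp only:) (intro trig_poly_sum trig_poly_cmult trig_poly_cis)
qed

text \<open>Links Stone-Weierstrass on the circle with exponential sums. Real-linear functionals
  restrict to combinations of the frequencies 1 and -1, and sums and products stay within
  \<open>trig_poly\<close>.\<close>

lemma trig_poly_real_polynomial: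
  assumes "real_polynomial_function p"
  shows "trig_poly (\<lambda>t. complex_of_real (p (cis (2 * pi * t))))"
  using assms
proof induction
  case (linear f)
  then interpret bounded_linear f .
  have f: "f z = Re z * f 1 + Im z * f \<i>" for z
  proof -
    have "f z = f (Re z *\<^sub>R 1 + Im z *\<^sub>R \<i>)"
      by (rule arg_cong[of _ _ f]) (simp add: complex_eq_iff)
    then show ?thesis by (simp add: add scale)
  qed
  have "(\<lambda>t. complex_of_real (f (cis (2 * pi * t)))) =
     (\<lambda>t. (f 1 / 2 - \<i> * f \<i> / 2) * cis (2 * pi * (of_int 1 * t))
        + (f 1 / 2 + \<i> * f \<i> / 2) * cis (2 * pi * (of_int (-1) * t)))"
    by (subst f) (auto simp: complex_eq_iff fun_eq_iff)
  then show ?case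
    by (simp only:) (intro trig_poly_add trig_poly_cmult trig_poly_cis)
qed (simp_all add: trig_poly_const trig_poly_add trig_poly_mult)

lemma has_integral_cis_int:
  "((\<lambda>t. cis (2 * pi * (of_int k * t))) has_integral (if k = 0 then 1 else 0)) {0..1}"
proof (cases "k = 0")
  case True
  then show ?thesis using has_integral_const_real[of "1::complex" 0 1] by simp
next
  case False
  define w where "w = \<i> * complex_of_real (2 * pi * of_int k)"
  have w: "w \<noteq> 0" using False by (simp add: w_def)
  have e: "cis (2 * pi * (of_int k * t)) = exp (of_real t * w)" for t
    by (simp add: cis_conv_exp w_def mult_ac)
  have "((\<lambda>t. exp (of_real t * w)) has_integral (exp (of_real 1 * w) / w - exp (of_real 0 * w) / w)) {0..1}"
  proof (rule fundamental_theorem_of_calculus)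
    show "((\<lambda>t. exp (of_real t * w) / w) has_vector_derivative exp (of_real t * w)) (at t within {0..1})" for t
      by (rule has_vector_derivative_real_field[where f = "\<lambda>z. exp (z * w) / w"])
        (use w in \<open>auto intro!: derivative_eq_intros\<close>)
  qed simp
  moreover have "exp (of_real 1 * w) = 1"
    using e[of 1] cis_multiple_2pi[of "of_int k"] by simp
  ultimately show ?thesis using False by (simp add: e)
qed

section \<open>Approximating indicators of intervals by trigonometric polynomials\<close>

lemma cis_2pi_eqD:
  assumes "cis (2 * pi * t) = cis (2 * pi * s)"
  obtains n :: int where "t - s = of_int n"
proof -
  have "cis (2 * pi * (t - s)) = 1"
    using assms by (simp add: right_diff_distrib cis_divide[symmetric])
  then have "cos (2 * pi * (t - s)) = 1" by (simp add: complex_eq_iff)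
  then obtain n :: int where "2 * pi * (t - s) = 2 * pi * of_int n"
    using cos_one_2pi_int by (auto simp: mult_ac)
  then have "t - s = of_int n" by (subst (asm) mult_left_cancel) auto
  then show thesis by (rule that)
qed

lemma continuous_on_trig_poly:
  assumes "trig_poly (\<lambda>t. complex_of_real (f t))"
  shows "continuous_on UNIV f"
proof -
  obtain K c where K: "finite K" "(\<lambda>t. complex_of_real (f t)) = (\<lambda>t. \<Sum>k\<in>K. c k * cis (2 * pi * (of_int k * t)))"
    using assms unfolding trig_poly_def by blast
  have "continuous_on UNIV (\<lambda>t. complex_of_real (f t))"
    unfolding K(2) by (intro continuous_intros)
  from continuous_on_Re[OF this] show ?thesis by simp
qed

text \<open>Each \<open>w j\<close> is a sum of two tents on the circle, centred at the images of
  \<open>a\<close> and \<open>b\<close>, with shrinking base. The height 2 keeps a tent at least 1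
  within distance \<open>1 / Suc j\<close> of its centre, as used below. Off finitely many points
  they tend to 0, and 4 is a common majorant.\<close>

lemma integral_boundary_bumps_tendsto:
  fixes a b :: real
  defines "w \<equiv> \<lambda>(j::nat) (z::complex). max 0 (2 - real (Suc j) * norm (z - cis (2 * pi * a)))
             + max 0 (2 - real (Suc j) * norm (z - cis (2 * pi * b)))"
  assumes "0 \<le> a" "a \<le> b" "b \<le> 1"
  shows "(\<lambda>j. integral {0..1} (\<lambda>t. w j (cis (2 * pi * t)))) \<longlonglongrightarrow> 0"
proof -
  \<comment> \<open>On the circle 0 and 1 coincide, so a tent centred at one end of
    \<open>[0, 1]\<close> is also seen at the other; hence the four candidate points.\<close>
  define N where "N = {t \<in> {0..1}. cis (2 * pi * t) = cis (2 * pi * a) \<or> cis (2 * pi * t) = cis (2 * pi * b)}"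
  have sub: "N \<subseteq> {0, 1, a, b}"
  proof -
    have "t = s \<or> t \<in> {0,1}" if eq: "cis (2 * pi * t) = cis (2 * pi * s)" and ts: "t \<in> {0..1}" "s \<in> {0..1}" for s t :: real
    proof -
      obtain n :: int where n: "t - s = of_int n" using cis_2pi_eqD[OF eq] by blast
      then have "\<bar>real_of_int n\<bar> \<le> 1" using ts by auto
      then have "n = 0 \<or> n = 1 \<or> n = -1" by linarith
      then show ?thesis using n ts by auto
    qed
    then show ?thesis using assms unfolding N_def by fastforce
  qed
  have lim: "(\<lambda>j. max 0 (2 - real (Suc j) * norm (z - u))) \<longlonglongrightarrow> (if z = u then 2 else 0)" for z u :: complex
  proof (cases "z = u")
    case False
    then have "norm (z - u) > 0" by simp
    then obtain j0 where j0: "2 / norm (z - u) < real j0" using reals_Archimedean2 by blast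
    have "max 0 (2 - real (Suc j) * norm (z - u)) = 0" if "j \<ge> j0" for j
    proof -
      have "2 < real j0 * norm (z - u)" using j0 \<open>norm (z - u) > 0\<close> by (simp add: field_simps)
      also have "\<dots> \<le> real (Suc j) * norm (z - u)" using that by (intro mult_right_mono) auto
      finally show ?thesis by simp
    qed
    then show ?thesis using False
      by (intro tendsto_eventually) (auto simp: eventually_sequentially simp del: of_nat_Suc)
  qed auto
  have "(\<lambda>j. integral {0..1} (\<lambda>t. w j (cis (2 * pi * t)))) \<longlonglongrightarrow>
     integral {0..1} (\<lambda>t. (if cis (2 * pi * t) = cis (2 * pi * a) then 2 else 0) +
         (if cis (2 * pi * t) = cis (2 * pi * b) then 2 else 0))"
  proof (rule dominated_convergence(2)[where h = "\<lambda>_. 4"])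
    show "(\<lambda>t. w j (cis (2 * pi * t))) integrable_on {0..1}" for j
      unfolding w_def by (intro integrable_continuous_real continuous_intros)
    show "norm (w j (cis (2 * pi * t))) \<le> 4" for j t
    proof -
      have "0 \<le> max 0 (2 - real (Suc j) * norm (cis (2 * pi * t) - u)) \<and>
          max 0 (2 - real (Suc j) * norm (cis (2 * pi * t) - u)) \<le> 2" for u by simp
      from this[of "cis (2 * pi * a)"] this[of "cis (2 * pi * b)"] show ?thesis
        unfolding w_def real_norm_def by linarith
    qed
    show "(\<lambda>j. w j (cis (2 * pi * t))) \<longlonglongrightarrow>
       (if cis (2 * pi * t) = cis (2 * pi * a) then 2 else 0) +
         (if cis (2 * pi * t) = cis (2 * pi * b) then 2 else 0)" for t
      unfolding w_def by (intro tendsto_add lim)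
  qed auto
  also have "integral {0..1} (\<lambda>t. (if cis (2 * pi * t) = cis (2 * pi * a) then 2 else 0) +
         (if cis (2 * pi * t) = cis (2 * pi * b) then 2 else (0::real))) = integral {0..1} (\<lambda>t::real. 0)"
  proof (rule integral_spike[where S = N])
    show "negligible N" using finite_subset[OF sub] by (intro negligible_finite) auto
  qed (auto simp: N_def)
  finally show ?thesis by simp
qed

lemma trig_poly_approx:
  fixes f :: "complex \<Rightarrow> real"
  assumes "continuous_on UNIV f" "0 < e"
  obtains P where "trig_poly (\<lambda>t. complex_of_real (P t))" "\<And>t. \<bar>f (cis (2 * pi * t)) - P t\<bar> < e"
proof -
  obtain p where p: "real_polynomial_function p" "\<And>z. z \<in> sphere 0 1 \<Longrightarrow> \<bar>f z - p z\<bar> < e"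
    using Stone_Weierstrass_real_polynomial_function[of "sphere 0 1" f e] assms continuous_on_subset
    by (metis compact_sphere top_greatest)
  show thesis
    by (rule that[of "\<lambda>t. p (cis (2 * pi * t))"]) (use p trig_poly_real_polynomial in auto)
qed

text \<open>Instead of a minorant and a majorant, one approximant \<open>T\<close> with an error
  majorant \<open>W\<close> of small mean. The bound \<open>\<bar>T t\<bar> \<le> 1\<close> is what
  allows products over the coordinates to be compared factor by factor. \<open>T\<close> comes from
  a Urysohn function on the circle, \<open>W\<close> from the boundary bumps, which cover the region
  where that function is uncontrolled.\<close>

lemma interval_trig_approx:
  fixes a b \<epsilon> :: real
  assumes ab: "0 \<le> a" "a \<le> b" "b \<le> 1" and I: "{a<..<b} \<subseteq> I" "I \<subseteq> {a..b}" and \<epsilon>: "0 < \<epsilon>"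
  obtains T W where "trig_poly (\<lambda>t. complex_of_real (T t))" "trig_poly (\<lambda>t. complex_of_real (W t))"
    "\<And>t. \<bar>T t\<bar> \<le> 1" "\<And>t. \<bar>indicator I (frac t) - T t\<bar> \<le> W t"
    "integral {0..1} W \<le> \<epsilon>" "\<bar>integral {0..1} T - (b - a)\<bar> \<le> \<epsilon>"
proof -
  define w where "w \<equiv> \<lambda>(j::nat) (z::complex). max 0 (2 - real (Suc j) * norm (z - cis (2 * pi * a)))
             + max 0 (2 - real (Suc j) * norm (z - cis (2 * pi * b)))"
  have "(\<lambda>j. integral {0..1} (\<lambda>t. w j (cis (2 * pi * t)))) \<longlonglongrightarrow> 0"
    unfolding w_def by (rule integral_boundary_bumps_tendsto[OF ab])
  then have "\<forall>\<^sub>F j in sequentially. integral {0..1} (\<lambda>t. w j (cis (2 * pi * t))) < \<epsilon> / 2"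
    using \<epsilon> by (intro order_tendstoD) auto
  then obtain j where j: "integral {0..1} (\<lambda>t. w j (cis (2 * pi * t))) < \<epsilon> / 2"
    using eventually_happens'[OF sequentially_bot] by blast
  define \<eta> where "\<eta> = 1 / real (Suc j)"
  have \<eta>: "\<eta> > 0" by (simp add: \<eta>_def)
  have wc: "continuous_on UNIV (w j)" unfolding w_def by (intro continuous_intros)
  have w0: "0 \<le> w j z" for z unfolding w_def by simp
  have w1: "1 \<le> w j z" if "norm (z - cis (2 * pi * a)) < \<eta> \<or> norm (z - cis (2 * pi * b)) < \<eta>" for z
  proof -
    have "real (Suc j) * x < 1 \<longleftrightarrow> x < \<eta>" for x by (simp add: \<eta>_def field_simps)
    then have "real (Suc j) * norm (z - cis (2 * pi * a)) < 1 \<or> real (Suc j) * norm (z - cis (2 * pi * b)) < 1"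
      using that by simp
    then show ?thesis unfolding w_def by (auto simp: max_def)
  qed
  define Far where "Far = {z. \<eta> \<le> norm (z - cis (2 * pi * a)) \<and> \<eta> \<le> norm (z - cis (2 * pi * b))}"
  define A where "A = (\<lambda>t. cis (2 * pi * t)) ` {a..b} \<inter> Far"
  define B where "B = (\<lambda>t. cis (2 * pi * t)) ` ({0..a} \<union> {b..1}) \<inter> Far"
  have Fc: "closed Far" unfolding Far_def
    by (intro closed_Collect_conj closed_Collect_le continuous_intros)
  have Ac: "closed A" unfolding A_def
    by (intro closed_Int compact_imp_closed compact_continuous_image continuous_intros Fc) auto
  have Bc: "closed B" unfolding B_def
    by (intro closed_Int compact_imp_closed compact_continuous_image continuous_intros Fc compact_Un) auto
  \<comment> \<open>Equal points on the circle have parameters differing by an integer.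
    \<open>Far\<close> excludes the endpoints, so \<open>t\<close> lies strictly inside
    \<open>(a, b)\<close> and the difference is below 1 in absolute value.\<close>
  have AB: "B \<inter> A = {}"
  proof -
    have False if st: "cis (2 * pi * t) = cis (2 * pi * s)" "t \<in> {a..b}" "s \<in> {0..a} \<union> {b..1}"
      and F: "cis (2 * pi * t) \<in> Far" for s t
    proof -
      have nt: "t \<noteq> a" "t \<noteq> b" using F \<eta> unfolding Far_def by auto
      obtain n :: int where n: "t - s = of_int n" by (rule cis_2pi_eqD[OF st(1)])
      have "\<bar>real_of_int n\<bar> < 1" using n nt st ab by auto
      then have "n = 0" by linarith
      then show False using n nt st by auto
    qed
    then show ?thesis unfolding A_def B_def by (auto simp: image_iff) metis+
  qed
  obtain f :: "complex \<Rightarrow> real" where f: "continuous_on UNIV f" "\<And>z. f z \<in> closed_segment 0 1"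
    "\<And>z. z \<in> B \<Longrightarrow> f z = 0" "\<And>z. z \<in> A \<Longrightarrow> f z = 1"
    using Urysohn[OF Bc Ac AB, of "0::real" 1] by blast
  have f01: "0 \<le> f z" "f z \<le> 1" for z using f(2)[of z] by (auto simp: closed_segment_eq_real_ivl)
  \<comment> \<open>Stated for every \<open>S\<close> between the open and the closed interval: it
    is used for \<open>I\<close> itself, and for \<open>{a..b}\<close> to compare the mean of
    \<open>T\<close> with \<open>b - a\<close>.\<close>
  have ind: "\<bar>indicator S t - f (cis (2 * pi * t))\<bar> \<le> w j (cis (2 * pi * t))"
    if S: "{a<..<b} \<subseteq> S" "S \<subseteq> {a..b}" and t: "t \<in> {0..1}" for S t
  proof (cases "cis (2 * pi * t) \<in> Far")
    case True
    show ?thesis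
    proof (cases "t \<in> S")
      case True
      then have "cis (2 * pi * t) \<in> A" using S \<open>_ \<in> Far\<close> by (auto simp: A_def)
      then show ?thesis using f(4) True w0 by simp
    next
      case False
      then have "t \<notin> {a<..<b}" using S by blast
      then have "t \<in> {0..a} \<union> {b..1}" using t by auto
      then have "cis (2 * pi * t) \<in> B" using \<open>_ \<in> Far\<close> by (auto simp: B_def)
      then show ?thesis using f(3) False w0 by simp
    qed
  next
    case False
    then have "1 \<le> w j (cis (2 * pi * t))" using w1 by (auto simp: Far_def not_le)
    moreover have "\<bar>indicator S t - f (cis (2 * pi * t))\<bar> \<le> 1"
      using f01[of "cis (2 * pi * t)"] by (auto simp: indicator_def)
    ultimately show ?thesis by linarith
  qed
  \<comment> \<open>The final \<open>W\<close> is at most the bump plus \<open>4 * d\<close>, so its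
    mean is at most \<open>\<epsilon> / 2 + 4 * d = \<epsilon>\<close>.\<close>
  define d where "d = \<epsilon> / 8"
  have d: "d > 0" using \<epsilon> by (simp add: d_def)
  obtain P where P: "trig_poly (\<lambda>t. complex_of_real (P t))" "\<And>t. \<bar>f (cis (2 * pi * t)) - P t\<bar> < d"
    using trig_poly_approx[OF f(1) d] by blast
  obtain Q where Q: "trig_poly (\<lambda>t. complex_of_real (Q t))" "\<And>t. \<bar>w j (cis (2 * pi * t)) - Q t\<bar> < d"
    using trig_poly_approx[OF wc d] by blast
  \<comment> \<open>Dividing by \<open>1 + d\<close> restores the bound 1 and costs a second
    \<open>d\<close>. Together with the error \<open>d\<close> of \<open>Q\<close> this explains the
    \<open>3 * d\<close> in \<open>W\<close>.\<close>
  define T where "T t = P t / (1 + d)" for t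
  define W where "W t = Q t + 3 * d" for t
  have Tf: "\<bar>f (cis (2 * pi * t)) - T t\<bar> \<le> 2 * d" for t
  proof -
    let ?f = "f (cis (2 * pi * t))"
    have "?f - T t = ((?f - P t) + d * ?f) / (1 + d)" using d by (simp add: T_def field_simps)
    also have "\<bar>\<dots>\<bar> \<le> \<bar>(?f - P t) + d * ?f\<bar> / 1" unfolding abs_divide using d by (intro divide_left_mono) auto
    also have "\<dots> \<le> d + d * 1"
      using P(2)[of t] f01[of "cis (2 * pi * t)"] d mult_left_mono[of ?f 1 d] mult_nonneg_nonneg[of d ?f]
      unfolding div_by_1 abs_le_iff abs_less_iff by linarith
    finally show ?thesis by simp
  qed
  have T1: "\<bar>T t\<bar> \<le> 1" for t
  proof -
    have "\<bar>P t\<bar> \<le> 1 + d" using P(2)[of t] f01[of "cis (2 * pi * t)"] by linarith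
    then show ?thesis using d by (simp add: T_def abs_divide)
  qed
  have SW: "\<bar>indicator S t - T t\<bar> \<le> W t"
    if S: "{a<..<b} \<subseteq> S" "S \<subseteq> {a..b}" and t: "t \<in> {0..1}" for S t
    using ind[OF S t] Tf[of t] Q(2)[of t] unfolding W_def by linarith
  have trT: "trig_poly (\<lambda>t. complex_of_real (T t))"
    using trig_poly_cmult[OF P(1), of "1 / (1 + d)"] by (simp add: T_def)
  have trW: "trig_poly (\<lambda>t. complex_of_real (W t))"
    using trig_poly_add[OF Q(1) trig_poly_const[of "3 * d"]] by (simp add: W_def)
  have per: "F (frac t) = F t" if "trig_poly (\<lambda>t. complex_of_real (F t))" for F t
  proof -
    obtain K c where K: "finite K" "(\<lambda>t. complex_of_real (F t)) = (\<lambda>t. \<Sum>k\<in>K. c k * cis (2 * pi * (of_int k * t)))"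
      using \<open>trig_poly (\<lambda>t. complex_of_real (F t))\<close> unfolding trig_poly_def by blast
    have "cis (2 * pi * (of_int k * frac t)) = cis (2 * pi * (of_int k * t))" for k
    proof -
      have "2 * pi * (of_int k * frac t) = 2 * pi * (of_int k * t) - 2 * pi * of_int (k * \<lfloor>t\<rfloor>)"
        by (simp add: frac_def algebra_simps)
      then show ?thesis using cis_multiple_2pi[of "of_int (k * \<lfloor>t\<rfloor>)"]
        by (simp add: cis_divide[symmetric] del: of_int_mult)
    qed
    then have "complex_of_real (F (frac t)) = complex_of_real (F t)"
      using fun_cong[OF K(2), of t] fun_cong[OF K(2), of "frac t"] by simp
    then show ?thesis by simp
  qed
  have iW: "W integrable_on {0..1}" and iT: "T integrable_on {0..1}"
    using continuous_on_trig_poly[OF trW] continuous_on_trig_poly[OF trT]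
    by (auto intro!: integrable_continuous_real intro: continuous_on_subset)
  have "integral {0..1} W \<le> integral {0..1} (\<lambda>t. w j (cis (2 * pi * t)) + 4 * d)"
  proof (rule integral_le)
    show "(\<lambda>t. w j (cis (2 * pi * t)) + 4 * d) integrable_on {0..1}"
      unfolding w_def by (intro integrable_continuous_real continuous_intros)
    show "W t \<le> w j (cis (2 * pi * t)) + 4 * d" for t
      using Q(2)[of t] unfolding W_def by linarith
  qed (rule iW)
  also have "\<dots> = integral {0..1} (\<lambda>t. w j (cis (2 * pi * t))) + 4 * d"
    by (subst integral_add) (auto simp: w_def intro!: integrable_continuous_real continuous_intros)
  finally have W\<epsilon>: "integral {0..1} W \<le> \<epsilon>" using j by (simp add: d_def)
  have "(indicator {a..b} has_integral (b - a)) {0..1}"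
  proof -
    have "((\<lambda>_. 1::real) has_integral (b - a)) {a..b}"
      using has_integral_const_real[of "1::real" a b] ab by simp
    then have "((\<lambda>t. if t \<in> {a..b} then 1 else (0::real)) has_integral (b - a)) {0..1}"
      using has_integral_restrict[of "{a..b}" "{0..1}" "\<lambda>_. 1::real"] ab by auto
    then show ?thesis by (simp add: indicator_def[abs_def] of_bool_def)
  qed
  then have "((\<lambda>t. indicator {a..b} t - T t) has_integral ((b - a) - integral {0..1} T)) {0..1}"
    by (intro has_integral_diff integrable_integral iT)
  moreover have "\<bar>indicator {a..b} t - T t\<bar> \<le> W t" if "t \<in> {0..1}" for t
    using that by (intro SW) auto
  ultimately have "norm ((b - a) - integral {0..1} T) \<le> integral {0..1} W"
    using integral_norm_bound_integral[of "\<lambda>t. indicator {a..b} t - T t" "{0..1}" W] iW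
    by (auto simp: has_integral_integrable_integral)
  then have T\<epsilon>: "\<bar>integral {0..1} T - (b - a)\<bar> \<le> \<epsilon>" using W\<epsilon> by (simp add: abs_minus_commute)
  have fr: "\<bar>indicator I (frac t) - T t\<bar> \<le> W t" for t
    using SW[OF I, of "frac t"] per[OF trT, of t] per[OF trW, of t] frac_lt_1[of t] by simp
  show thesis by (rule that[OF trT trW T1 fr W\<epsilon> T\<epsilon>])
qed


lemma trig_poly_mean:
  assumes "finite K" and "\<And>t. complex_of_real (f t) = (\<Sum>k\<in>K. c k * cis (2 * pi * (of_int k * t)))"
  shows "complex_of_real (integral {0..1} f) = (if 0 \<in> K then c 0 else 0)"
proof -
  have "((\<lambda>t. complex_of_real (f t)) has_integral (\<Sum>k\<in>K. c k * (if k = 0 then 1 else 0))) {0..1}"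
    unfolding assms(2) by (intro has_integral_sum assms(1) has_integral_mult_right has_integral_cis_int)
  also have "(\<Sum>k\<in>K. c k * (if k = 0 then 1 else 0)) = (if 0 \<in> K then c 0 else 0)"
    using assms(1) by (auto simp: if_distrib cong: if_cong)
  finally have 1: "((\<lambda>t. complex_of_real (f t)) has_integral (if 0 \<in> K then c 0 else 0)) {0..1}" .
  then have "(f has_integral Re (if 0 \<in> K then c 0 else 0)) {0..1}"
    using has_integral_Re[OF 1] by simp
  then have "f integrable_on {0..1}" by blast
  then have "((\<lambda>t. complex_of_real (f t)) has_integral complex_of_real (integral {0..1} f)) {0..1}"
    by (intro has_integral_of_real integrable_integral)
  then show ?thesis using 1 by (rule has_integral_unique)
qed

text \<open>Multiplying out turns the product into a finite sum over frequency vectors. The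
  hypothesis removes every non-zero vector in the limit, and the zero vector carries the product of
  the mean values.\<close>

lemma trig_poly_product_average:
  fixes x :: "nat \<Rightarrow> real ^ 'd" and f :: "'d \<Rightarrow> real \<Rightarrow> real"
  assumes weyl: "\<And>k :: 'd \<Rightarrow> int. k \<noteq> (\<lambda>_. 0) \<Longrightarrow>
      (\<lambda>N. (\<Sum>n\<in>{1..N}. cis (2 * pi * (\<Sum>i\<in>UNIV. of_int (k i) * x n $ i))) / of_nat N) \<longlonglongrightarrow> 0"
    and f: "\<And>i. trig_poly (\<lambda>t. complex_of_real (f i t))"
  shows "(\<lambda>N. (\<Sum>n\<in>{1..N}. \<Prod>i\<in>UNIV. f i (x n $ i)) / real N) \<longlonglongrightarrow> (\<Prod>i\<in>UNIV. integral {0..1} (f i))"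
proof -
  obtain K c where K: "\<And>i. finite (K i)"
    and Kc: "\<And>i t. complex_of_real (f i t) = (\<Sum>k\<in>K i. c i k * cis (2 * pi * (of_int k * t)))"
    using f unfolding trig_poly_def fun_eq_iff by metis
  let ?E = "\<lambda>k n. cis (2 * pi * (\<Sum>i\<in>UNIV. of_int (k i) * x n $ i))"
  let ?P = "PiE UNIV K" and ?C = "\<lambda>k. \<Prod>i\<in>UNIV. c i (k i)"
  have fin: "finite ?P" using K by (intro finite_PiE) auto
  have cis_sum: "(\<Prod>i\<in>UNIV. cis (h i)) = cis (\<Sum>i\<in>UNIV. h i)" for h :: "'d \<Rightarrow> real"
    by (simp add: cis_conv_exp exp_sum[symmetric] sum_distrib_left)
  have prod: "complex_of_real (\<Prod>i\<in>UNIV. f i (x n $ i)) = (\<Sum>k\<in>?P. ?C k * ?E k n)" for n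
    unfolding of_real_prod Kc
    by (subst prod_sum_PiE) (auto simp: K prod.distrib cis_sum sum_distrib_left)
  have avg: "complex_of_real ((\<Sum>n\<in>{1..N}. \<Prod>i\<in>UNIV. f i (x n $ i)) / real N)
      = (\<Sum>k\<in>?P. ?C k * ((\<Sum>n\<in>{1..N}. ?E k n) / of_nat N))" for N
  proof -
    have "complex_of_real (\<Sum>n\<in>{1..N}. \<Prod>i\<in>UNIV. f i (x n $ i)) = (\<Sum>n\<in>{1..N}. \<Sum>k\<in>?P. ?C k * ?E k n)"
      unfolding of_real_sum prod by (rule refl)
    also have "\<dots> = (\<Sum>k\<in>?P. ?C k * (\<Sum>n\<in>{1..N}. ?E k n))"
      by (subst sum.swap) (simp add: sum_distrib_left)
    finally show ?thesis
      unfolding of_real_divide of_real_of_nat_eq times_divide_eq_right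
      by (simp only: sum_divide_distrib[symmetric])
  qed
  have lim: "(\<lambda>N. (\<Sum>n\<in>{1..N}. ?E k n) / of_nat N) \<longlonglongrightarrow> (if k = (\<lambda>_. 0) then 1 else 0)" for k
  proof (cases "k = (\<lambda>_. 0)")
    case True
    have "\<forall>\<^sub>F N in sequentially. (\<Sum>n\<in>{1..N}. ?E k n) / of_nat N = 1"
      using eventually_gt_at_top[of 0] by eventually_elim (simp add: True)
    then show ?thesis using True by (simp add: tendsto_eventually)
  qed (use weyl in simp)
  have "(\<lambda>N. complex_of_real ((\<Sum>n\<in>{1..N}. \<Prod>i\<in>UNIV. f i (x n $ i)) / real N))
     \<longlonglongrightarrow> (\<Sum>k\<in>?P. ?C k * (if k = (\<lambda>_. 0) then 1 else 0))"
    unfolding avg by (intro tendsto_sum tendsto_mult tendsto_const lim)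
  also have "(\<Sum>k\<in>?P. ?C k * (if k = (\<lambda>_. 0) then 1 else 0)) = (if (\<lambda>_. 0) \<in> ?P then ?C (\<lambda>_. 0) else 0)"
    using fin by (auto simp: if_distrib cong: if_cong)
  also have "\<dots> = (\<Prod>i\<in>UNIV. if 0 \<in> K i then c i 0 else 0)"
    by (auto simp: PiE_iff)
  also have "\<dots> = complex_of_real (\<Prod>i\<in>UNIV. integral {0..1} (f i))"
    unfolding of_real_prod by (intro prod.cong refl trig_poly_mean[symmetric] K Kc)
  finally show ?thesis by (simp only: tendsto_of_real_iff)
qed

section \<open>Boxes with arbitrary faces, and the criterion itself\<close>

lemma interval_subset_unit_endpoints:
  assumes "is_interval I" "I \<subseteq> {0..1::real}"
  obtains a b where "0 \<le> a" "a \<le> b" "b \<le> 1" "{a<..<b} \<subseteq> I" "I \<subseteq> {a..b}"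
proof (cases "I = {}")
  case True
  then show ?thesis using that[of 0 0] by auto
next
  case False
  have bdd: "bdd_above I" "bdd_below I" using assms(2) by (auto intro: bdd_above_mono bdd_below_mono)
  show ?thesis
  proof (rule that)
    show "0 \<le> Inf I" using assms False by (intro cInf_greatest) auto
    show "Sup I \<le> 1" using assms False by (intro cSup_least) auto
    show "Inf I \<le> Sup I" using bdd False by (simp add: cInf_le_cSup)
    show "I \<subseteq> {Inf I..Sup I}" using bdd by (auto intro: cInf_lower cSup_upper)
    show "{Inf I<..<Sup I} \<subseteq> I"
    proof
      fix t assume "t \<in> {Inf I<..<Sup I}"
      then obtain u v where "u \<in> I" "u < t" "v \<in> I" "t < v"
        using bdd False by (auto simp: cInf_less_iff less_cSup_iff)
      then show "t \<in> I" using assms(1) unfolding is_interval_1 by (meson less_imp_le)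
    qed
  qed
qed

text \<open>The set lies between the open and the closed box, so it differs from the latter only
  inside the frontier, a null set.\<close>

lemma measure_box_like:
  fixes I :: "'d::finite \<Rightarrow> real set"
  assumes "\<And>i. a i \<le> b i" "\<And>i. {a i<..<b i} \<subseteq> I i" "\<And>i. I i \<subseteq> {a i..b i}"
  shows "measure lebesgue {y :: real ^ 'd. \<forall>i. y $ i \<in> I i} = (\<Prod>i\<in>UNIV. b i - a i)"
proof -
  let ?a = "(\<chi> i. a i) :: real ^ 'd" and ?b = "(\<chi> i. b i) :: real ^ 'd"
  let ?S = "{y :: real ^ 'd. \<forall>i. y $ i \<in> I i}"
  have sub: "box ?a ?b \<subseteq> ?S" "?S \<subseteq> cbox ?a ?b"
    using assms by (force simp: mem_box_cart)+
  have "measure lebesgue ?S = measure lebesgue (cbox ?a ?b)"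
    by (rule measure_negligible_symdiff)
      (use sub in \<open>auto intro!: negligible_subset[OF negligible_frontier_interval[of ?a ?b]]\<close>)
  also have "\<dots> = (\<Prod>i\<in>UNIV. b i - a i)"
    using assms(1) by (simp add: content_cbox_cart interval_ne_empty_cart)
  finally show ?thesis .
qed

text \<open>A product of factors of modulus at most 1 changes by at most the sum of the changes of
  its factors. The error for a box is thus bounded by one-dimensional errors \<open>W j\<close>,
  whose averages are again governed by the hypothesis.\<close>

theorem weyl_criterion:
  fixes x :: "nat \<Rightarrow> real ^ 'd"
  assumes weyl: "\<And>k :: 'd \<Rightarrow> int. k \<noteq> (\<lambda>_. 0) \<Longrightarrow>
      (\<lambda>N. (\<Sum>n\<in>{1..N}. cis (2 * pi * (\<Sum>i\<in>UNIV. of_int (k i) * x n $ i))) / of_nat N) \<longlonglongrightarrow> 0"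
  shows "uniformly_distributed_mod1 x"
  unfolding uniformly_distributed_mod1_def
proof (intro allI impI)
  fix I :: "'d \<Rightarrow> real set"
  assume "\<forall>i. is_interval (I i) \<and> I i \<subseteq> {0..1}"
  then have "\<exists>a b. 0 \<le> a \<and> a \<le> b \<and> b \<le> 1 \<and> {a<..<b} \<subseteq> I i \<and> I i \<subseteq> {a..b}" for i
    using interval_subset_unit_endpoints[of "I i"] by metis
  then obtain a b where ab: "\<And>i. 0 \<le> a i" "\<And>i. a i \<le> b i" "\<And>i. b i \<le> 1"
    "\<And>i. {a i<..<b i} \<subseteq> I i" "\<And>i. I i \<subseteq> {a i..b i}"
    by metis
  let ?F = "\<lambda>n. \<Prod>i\<in>UNIV. indicator (I i) (frac (x n $ i)) :: real"
  let ?M = "\<Prod>i\<in>UNIV. b i - a i"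
  have cnt: "real (card {n \<in> {1..N}. \<forall>i. frac (x n $ i) \<in> I i}) = (\<Sum>n\<in>{1..N}. ?F n)" for N
  proof -
    have "?F n = (if \<forall>i. frac (x n $ i) \<in> I i then 1 else 0)" for n
      by (auto simp: indicator_def prod_zero_iff)
    then show ?thesis by (simp add: sum.If_cases Int_def)
  qed
  have lim: "(\<lambda>N. (\<Sum>n\<in>{1..N}. ?F n) / real N) \<longlonglongrightarrow> ?M"
  proof (rule LIMSEQ_I)
    fix e :: real assume e: "0 < e"
    define d where "d = real CARD('d)"
    \<comment> \<open>The errors are below \<open>2 * d * \<epsilon>\<close> (indicators against
      \<open>T\<close>), below \<open>d * \<epsilon>\<close> (average of \<open>T\<close> against
      its limit) and at most \<open>d * \<epsilon>\<close> (that limit against the volume); they add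
      up to less than \<open>4 * d * \<epsilon> = e\<close>.\<close>
    define \<epsilon> where "\<epsilon> = e / (4 * d)"
    have d: "d > 0" by (simp add: d_def)
    have \<epsilon>: "\<epsilon> > 0" using e d by (simp add: \<epsilon>_def)
    have "\<exists>T W. trig_poly (\<lambda>t. complex_of_real (T t)) \<and> trig_poly (\<lambda>t. complex_of_real (W t)) \<and>
      (\<forall>t. \<bar>T t\<bar> \<le> 1) \<and> (\<forall>t. \<bar>indicator (I i) (frac t) - T t\<bar> \<le> W t) \<and>
      integral {0..1} W \<le> \<epsilon> \<and> \<bar>integral {0..1} T - (b i - a i)\<bar> \<le> \<epsilon>" for i
      using interval_trig_approx[OF ab(1,2,3,4,5) \<epsilon>, of i] by metis
    then obtain T W where tr: "\<And>i. trig_poly (\<lambda>t. complex_of_real (T i t))"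
        "\<And>i. trig_poly (\<lambda>t. complex_of_real (W i t))"
      and T1: "\<And>i t. \<bar>T i t\<bar> \<le> 1"
      and TW: "\<And>i t. \<bar>indicator (I i) (frac t) - T i t\<bar> \<le> W i t"
      and W\<epsilon>: "\<And>i. integral {0..1} (W i) \<le> \<epsilon>"
      and T\<epsilon>: "\<And>i. \<bar>integral {0..1} (T i) - (b i - a i)\<bar> \<le> \<epsilon>"
      by metis
    have "norm (integral {0..1} (T i)) \<le> 1 * (1 - 0)" for i
      by (rule integral_bound) (use T1 continuous_on_trig_poly[OF tr(1)[of i]] in
        \<open>auto intro: continuous_on_subset\<close>)
    then have "norm ((\<Prod>i\<in>UNIV. integral {0..1} (T i)) - ?M) \<le> (\<Sum>i\<in>UNIV. norm (integral {0..1} (T i) - (b i - a i)))"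
    proof (intro norm_prod_diff)
      show "norm (b i - a i) \<le> 1" for i using ab(1,2,3)[of i] by simp
    qed simp_all
    also have "\<dots> \<le> (\<Sum>i\<in>(UNIV :: 'd set). \<epsilon>)" using T\<epsilon> by (intro sum_mono) simp
    finally have TM: "\<bar>(\<Prod>i\<in>UNIV. integral {0..1} (T i)) - ?M\<bar> \<le> d * \<epsilon>" by (simp add: d_def)
    have T: "(\<lambda>N. (\<Sum>n\<in>{1..N}. \<Prod>i\<in>UNIV. T i (x n $ i)) / real N) \<longlonglongrightarrow> (\<Prod>i\<in>UNIV. integral {0..1} (T i))"
      by (rule trig_poly_product_average[OF weyl tr(1)])
    \<comment> \<open>A function of one coordinate is a product whose other factors are the constant
      1, so the product lemma covers it.\<close>
    have W: "(\<lambda>N. (\<Sum>n\<in>{1..N}. W j (x n $ j)) / real N) \<longlonglongrightarrow> integral {0..1} (W j)" for j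
    proof -
      have 1: "(\<Prod>i\<in>UNIV. if i = j then h i else 1) = h j" for h :: "'d \<Rightarrow> real"
        by (simp add: prod.If_cases)
      have "(\<Prod>i\<in>UNIV. (if i = j then W i else (\<lambda>_. 1)) (x n $ i)) = W j (x n $ j)" for n
        using 1[of "\<lambda>i. W i (x n $ i)"] by (simp add: if_distrib[of "\<lambda>g. g _"] cong: if_cong)
      moreover have "(\<Prod>i\<in>UNIV. integral {0..1} (if i = j then W i else (\<lambda>_. 1))) = integral {0..1} (W j)"
        using 1[of "\<lambda>i. integral {0..1} (W i)"] by (simp add: if_distrib[of "integral _"] cong: if_cong)
      moreover have "trig_poly (\<lambda>t. complex_of_real ((if i = j then W i else (\<lambda>_. 1)) t))" for i
        using tr(2)[of i] trig_poly_const[of 1] by (cases "i = j") simp_all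
      ultimately show ?thesis
        using trig_poly_product_average[OF weyl, of "\<lambda>i. if i = j then W i else (\<lambda>_. 1)"] by simp
    qed
    have W_sum: "(\<lambda>N. \<Sum>j\<in>UNIV. (\<Sum>n\<in>{1..N}. W j (x n $ j)) / real N) \<longlonglongrightarrow> (\<Sum>j\<in>UNIV. integral {0..1} (W j))"
      by (intro tendsto_sum W)
    have "(\<Sum>j\<in>UNIV. integral {0..1} (W j)) \<le> (\<Sum>j\<in>(UNIV :: 'd set). \<epsilon>)" using W\<epsilon> by (intro sum_mono) simp
    then have "(\<Sum>j\<in>UNIV. integral {0..1} (W j)) \<le> d * \<epsilon>" by (simp add: d_def)
    then have W_le: "(\<Sum>j\<in>UNIV. integral {0..1} (W j)) < 2 * (d * \<epsilon>)" using mult_pos_pos[OF d \<epsilon>] by linarith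
    have FT: "\<bar>(\<Sum>n\<in>{1..N}. ?F n) / real N - (\<Sum>n\<in>{1..N}. \<Prod>i\<in>UNIV. T i (x n $ i)) / real N\<bar>
        \<le> (\<Sum>j\<in>UNIV. (\<Sum>n\<in>{1..N}. W j (x n $ j)) / real N)" for N
    proof -
      have "\<bar>?F n - (\<Prod>i\<in>UNIV. T i (x n $ i))\<bar> \<le> (\<Sum>j\<in>UNIV. W j (x n $ j))" for n
      proof -
        have "norm (?F n - (\<Prod>i\<in>UNIV. T i (x n $ i))) \<le>
           (\<Sum>j\<in>UNIV. norm (indicator (I j) (frac (x n $ j)) - T j (x n $ j)))"
          using T1 by (intro norm_prod_diff) (auto simp: indicator_def)
        also have "\<dots> \<le> (\<Sum>j\<in>UNIV. W j (x n $ j))" using TW by (intro sum_mono) simp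
        finally show ?thesis by simp
      qed
      then have "\<bar>(\<Sum>n\<in>{1..N}. ?F n) - (\<Sum>n\<in>{1..N}. \<Prod>i\<in>UNIV. T i (x n $ i))\<bar> \<le> (\<Sum>n\<in>{1..N}. \<Sum>j\<in>UNIV. W j (x n $ j))"
        unfolding sum_subtractf[symmetric] by (intro order.trans[OF sum_abs] sum_mono)
      also have "\<dots> = (\<Sum>j\<in>UNIV. \<Sum>n\<in>{1..N}. W j (x n $ j))" by (rule sum.swap)
      finally show ?thesis
        unfolding diff_divide_distrib[symmetric] abs_divide sum_divide_distrib[symmetric]
        by (simp add: divide_right_mono)
    qed
    have "\<forall>\<^sub>F N in sequentially. norm ((\<Sum>n\<in>{1..N}. ?F n) / real N - ?M) < e"
      using order_tendstoD(2)[OF W_sum W_le] tendstoD[OF T mult_pos_pos[OF d \<epsilon>]]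
    proof eventually_elim
      case (elim N)
      have "4 * (d * \<epsilon>) = e" using d by (simp add: \<epsilon>_def)
      then show ?case using elim FT[of N] TM unfolding dist_real_def real_norm_def by linarith
    qed
    then show "\<exists>N0. \<forall>N\<ge>N0. norm ((\<Sum>n\<in>{1..N}. ?F n) / real N - ?M) < e"
      by (simp add: eventually_sequentially)
  qed
  show "(\<lambda>N. real (card {n \<in> {1..N}. \<forall>i. frac (x n $ i) \<in> I i}) / real N)
          \<longlonglongrightarrow> measure lebesgue {y :: real ^ 'd. \<forall>i. y $ i \<in> I i}"
    unfolding cnt measure_box_like[OF ab(2,4,5)] by (rule lim)
qed

section \<open>The main theorem\<close>

text \<open>Adding the constants makes one bound fit the capped kernel: \<open>len\<close> takes
  care of equal values and of the cap 1, \<open>C\<close> of the decay.\<close>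

lemma le_scatter_kernel:
  fixes I C len \<delta> u v :: real
  assumes "I \<le> len" "0 \<le> C" "0 \<le> len" and "u \<noteq> v \<Longrightarrow> I \<le> C * \<bar>u - v\<bar> powr (- \<delta>)"
  shows "I \<le> (C + len) * (if u = v then 1 else min (\<bar>u - v\<bar> powr (- \<delta>)) 1)"
proof (cases "u = v")
  case False
  have "C * \<bar>u - v\<bar> powr (- \<delta>) \<le> (C + len) * \<bar>u - v\<bar> powr (- \<delta>)"
    using assms by (intro mult_right_mono) auto
  then have "I \<le> (C + len) * \<bar>u - v\<bar> powr (- \<delta>)" using assms(4)[OF False] by linarith
  then show ?thesis using False assms(1,2) by (auto simp: min_def)
qed (use assms in simp)

text \<open>The quantity \<open>\<Sum>d. \<bar>coeff (\<Sum>i. t i p i) d\<bar>\<close> over \<open>d \<ge> 1\<close> is a norm in \<open>t\<close>, hence comparable to any other one.\<close>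

lemma independent_poly_family_coeff_bound:
  fixes p :: "'k::finite \<Rightarrow> real poly"
  assumes ind: "independent_poly_family (\<lambda>j :: 'k option. case j of None \<Rightarrow> 1 | Some i \<Rightarrow> p i)"
    and deg: "\<And>i. degree (p i) \<le> D" and D: "1 \<le> D"
  obtains c where "0 < c" and "\<And>t i. \<exists>d\<in>{1..D}. c * \<bar>t i\<bar> \<le> \<bar>coeff (\<Sum>i\<in>UNIV. smult (t i) (p i)) d\<bar>"
proof -
  define N where "N t = (\<Sum>d\<in>{1..D}. \<bar>\<Sum>i\<in>UNIV. t $ i * coeff (p i) d\<bar>)" for t :: "real ^ 'k"
  have scale: "N (r *\<^sub>R t) = \<bar>r\<bar> * N t" for r t
    by (simp add: N_def sum_distrib_left[symmetric] abs_mult mult.assoc)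
  have pos: "N t \<noteq> 0" if "t \<noteq> 0" for t
  proof
    assume "N t = 0"
    define Q where "Q = (\<Sum>i\<in>UNIV. smult (t $ i) (p i))"
    have "coeff Q d = 0" if "0 < d" for d
    proof (cases "d \<le> D")
      case True
      then show ?thesis
        using \<open>N t = 0\<close> that by (simp add: N_def Q_def coeff_sum sum_nonneg_eq_0_iff)
    next
      case False
      then have "coeff (p i) d = 0" for i using deg[of i] by (intro coeff_eq_0) simp
      then show ?thesis by (simp add: Q_def coeff_sum)
    qed
    then have Q: "Q = [:coeff Q 0:]" by (intro poly_eqI) (auto simp: coeff_pCons split: nat.split)
    \<comment> \<open>If all non-constant coefficients vanish, \<open>Q\<close> is a constant; the
      member \<open>1\<close> of the family, with weight \<open>- coeff Q 0\<close>, cancels it and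
      yields a forbidden relation.\<close>
    define c where "c j = (case j of None \<Rightarrow> - coeff Q 0 | Some i \<Rightarrow> t $ i)" for j
    have "(\<Sum>j\<in>UNIV. smult (c j) (case j of None \<Rightarrow> 1 | Some i \<Rightarrow> p i)) = smult (- coeff Q 0) 1 + Q"
      by (simp add: UNIV_option_conv sum.reindex c_def Q_def)
    also have "\<dots> = 0" by (subst (2) Q) (simp add: one_pCons)
    finally have "c j = 0" for j using ind unfolding independent_poly_family_def by blast
    from this[of "Some _"] show False using that by (simp add: c_def vec_eq_iff)
  qed
  have "continuous_on (sphere 0 1) N" unfolding N_def by (intro continuous_intros)
  \<comment> \<open>A minimum needs a non-empty sphere; any index gives a unit vector.\<close>
  moreover have "axis undefined 1 \<in> sphere (0 :: real ^ 'k) 1" by (simp)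
  ultimately obtain t0 where t0: "t0 \<in> sphere 0 1" "\<And>t. t \<in> sphere 0 1 \<Longrightarrow> N t0 \<le> N t"
    using continuous_attains_inf[of "sphere 0 1" N] by (metis compact_sphere empty_iff)
  have N0: "0 < N t0"
  proof -
    have "t0 \<noteq> 0" using t0(1) by auto
    moreover have "0 \<le> N t0" by (simp add: N_def sum_nonneg)
    ultimately show ?thesis using pos[of t0] by linarith
  qed
  have Nge: "N t0 * norm t \<le> N t" for t
  proof (cases "t = 0")
    case False
    then have "N t0 \<le> N ((1 / norm t) *\<^sub>R t)" by (intro t0(2)) simp
    then show ?thesis using False by (simp add: scale field_simps)
  qed (simp add: N_def)
  show thesis
  \<comment> \<open>Pigeonhole: if all \<open>D\<close> coefficients were smaller than this share,
    their sum would fall below \<open>N t0 * norm t\<close>.\<close>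
  proof (rule that[of "N t0 / real D"])
    show "0 < N t0 / real D" using N0 D by simp
    fix t :: "'k \<Rightarrow> real" and i
    show "\<exists>d\<in>{1..D}. N t0 / real D * \<bar>t i\<bar> \<le> \<bar>coeff (\<Sum>i\<in>UNIV. smult (t i) (p i)) d\<bar>"
    proof (rule ccontr)
      assume "\<not> ?thesis"
      then have lt: "\<And>d. d \<in> {1..D} \<Longrightarrow> \<bar>\<Sum>i\<in>UNIV. (\<chi> i. t i) $ i * coeff (p i) d\<bar> < N t0 / real D * \<bar>t i\<bar>"
        by (force simp: coeff_sum)
      have "N (\<chi> i. t i) = (\<Sum>d\<in>{1..D}. \<bar>\<Sum>i\<in>UNIV. (\<chi> i. t i) $ i * coeff (p i) d\<bar>)"
        by (simp only: N_def)
      also have "\<dots> < (\<Sum>d\<in>{1..D}. N t0 / real D * \<bar>t i\<bar>)"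
        using D by (intro sum_strict_mono lt) auto
      also have "\<dots> = N t0 * \<bar>(\<chi> i. t i) $ i\<bar>" using D by simp
      also have "\<dots> \<le> N t0 * norm (\<chi> i. t i)" using N0 by (intro mult_left_mono component_le_norm_cart) auto
      finally show False using Nge[of "\<chi> i. t i"] by simp
    qed
  qed
qed

text \<open>In the jointly scattered case take \<open>d = degree (p i0)\<close>: the d-th
  coefficient of the difference is exactly \<open>s n - s m\<close> for a combination
  \<open>s\<close> of the \<open>a i\<close>, non-trivial because its weight at \<open>i0\<close>
  contains the leading coefficient of \<open>p i0\<close>. In the independent case
  \<open>s = a i0\<close>, and the index \<open>d\<close> depends on \<open>n\<close> and
  \<open>m\<close>.\<close>

lemma scattered_dominating_sequence:
  fixes p :: "'k::finite \<Rightarrow> real poly" and a :: "'k \<Rightarrow> nat \<Rightarrow> real" and l :: "'k \<Rightarrow> real"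
  assumes deg: "\<And>i. 0 < degree (p i)" "\<And>i. degree (p i) \<le> D" and l: "l i0 \<noteq> 0"
    and sc: "\<And>i. scattered (a i)"
    and alt: "jointly_scattered a \<or>
         independent_poly_family (\<lambda>j :: 'k option. case j of None \<Rightarrow> 1 | Some i \<Rightarrow> p i)"
  obtains s c where "scattered s" "0 < c"
    "\<And>n m. \<exists>d\<in>{1..D}. c * \<bar>s n - s m\<bar> \<le> \<bar>coeff (\<Sum>i\<in>UNIV. smult (l i * (a i n - a i m)) (p i)) d\<bar>"
  using alt
proof
  assume js: "jointly_scattered a"
  define d where "d = degree (p i0)"
  define v :: "real ^ 'k" where "v = (\<chi> i. l i * coeff (p i) d)"
  have "coeff (p i0) d \<noteq> 0" using deg(1)[of i0] by (auto simp: d_def)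
  then have "v $ i0 \<noteq> 0" using l by (simp add: v_def)
  then have "v \<noteq> 0" by auto
  then have "scattered (\<lambda>n. \<Sum>i\<in>UNIV. v $ i * a i n)" using js unfolding jointly_scattered_def by blast
  moreover have "1 * \<bar>(\<Sum>i\<in>UNIV. v $ i * a i n) - (\<Sum>i\<in>UNIV. v $ i * a i m)\<bar> \<le>
     \<bar>coeff (\<Sum>i\<in>UNIV. smult (l i * (a i n - a i m)) (p i)) d\<bar>" for n m
    by (simp add: coeff_sum sum_subtractf[symmetric] v_def algebra_simps)
  moreover have "d \<in> {1..D}" using deg[of i0] by (simp add: d_def)
  ultimately show thesis by (intro that[of _ 1]) (simp, simp, blast)
next
  assume ind: "independent_poly_family (\<lambda>j :: 'k option. case j of None \<Rightarrow> 1 | Some i \<Rightarrow> p i)"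
  have "1 \<le> D" using deg[of i0] by simp
  then obtain c where c: "0 < c"
    "\<And>t i. \<exists>d\<in>{1..D}. c * \<bar>t i\<bar> \<le> \<bar>coeff (\<Sum>i\<in>UNIV. smult (t i) (p i)) d\<bar>"
    using independent_poly_family_coeff_bound[OF ind deg(2)] by blast
  show thesis
  proof (rule that[of "a i0" "c * \<bar>l i0\<bar>"])
    show "\<exists>d\<in>{1..D}. c * \<bar>l i0\<bar> * \<bar>a i0 n - a i0 m\<bar> \<le>
       \<bar>coeff (\<Sum>i\<in>UNIV. smult (l i * (a i n - a i m)) (p i)) d\<bar>" for n m
      using c(2)[of "\<lambda>i. l i * (a i n - a i m)" i0] by (simp only: abs_mult mult.assoc)
  qed (use sc c l in auto)
qed

text \<open>Here the oscillatory bounds meet scatteredness. The exponent \<delta> is dictated by the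
  degrees of the polynomials and can be arbitrarily small, hence the demand that
  \<open>scattered\<close> quantify over all \<delta>.\<close>

lemma exponential_sums_on_interval:
  fixes g :: "real \<Rightarrow> real" and b :: "nat \<Rightarrow> real"
    and p :: "'k::finite \<Rightarrow> real poly" and a :: "'k \<Rightarrow> nat \<Rightarrow> real" and l :: "'k \<Rightarrow> real"
  assumes g1: "\<And>x. 1 < g x" and g: "real_analytic g"
    and b: "scattered b" "filterlim b at_top sequentially"
    and deg: "\<And>i. 0 < degree (p i)" and sc: "\<And>i. scattered (a i)"
    and alt: "jointly_scattered a \<or>
         independent_poly_family (\<lambda>j :: 'k option. case j of None \<Rightarrow> 1 | Some i \<Rightarrow> p i)"
    and nonzero: "L \<noteq> 0 \<or> (\<exists>i. l i \<noteq> 0)"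
    and uv: "u \<le> v" and nz: "\<And>x. x \<in> {u..v} \<Longrightarrow> deriv g x \<noteq> 0"
  shows "AE x in lebesgue. x \<in> {u..v} \<longrightarrow>
    (\<lambda>N. (\<Sum>n\<in>{1..N}. cis (L * g x powr b n + (\<Sum>i\<in>UNIV. l i * (a i n * poly (p i) x)))) / of_nat N) \<longlonglongrightarrow> 0"
proof -
  define \<phi> where "\<phi> n x = L * g x powr b n + (\<Sum>i\<in>UNIV. l i * (a i n * poly (p i) x))" for n x
  define P where "P n m = (\<Sum>i\<in>UNIV. smult (l i * (a i n - a i m)) (p i))" for n m
  define D where "D = (\<Sum>i\<in>UNIV. degree (p i))"
  have degD: "degree (p i) \<le> D" for i unfolding D_def by (rule member_le_sum) auto
  have D: "1 \<le> D" using deg[of undefined] degD[of undefined] by simp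
  have P_deg: "degree (P n m) \<le> D" for n m
    unfolding P_def by (intro degree_sum_le finite order.trans[OF degree_smult_le degD])
  have diff: "\<phi> n x - \<phi> m x = L * (g x powr b n - g x powr b m) + poly (P n m) x" for n m x
  proof -
    have "poly (P n m) x = (\<Sum>i\<in>UNIV. l i * (a i n * poly (p i) x) - l i * (a i m * poly (p i) x))"
      unfolding P_def poly_sum by (intro sum.cong refl) (simp add: algebra_simps)
    then show ?thesis unfolding \<phi>_def sum_subtractf by (simp add: right_diff_distrib)
  qed
  have g0: "g x \<noteq> 0" for x using g1[of x] by simp
  have cont: "continuous_on {u..v} (\<phi> n)" for n
    unfolding \<phi>_def using g0
    by (intro continuous_intros real_analytic_continuous_on[OF g]) auto
  have len: "norm (integral {u..v} (\<lambda>x. cis (\<phi> n x - \<phi> m x))) \<le> v - u" for n m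
    by (intro norm_integral_cis_le_length uv continuous_intros cont)
  \<comment> \<open>The common form of both cases: \<open>s\<close> is \<open>b\<close> when
    \<open>L \<noteq> 0\<close>, and otherwise the sequence dominated by a coefficient of the
    polynomial phase.\<close>
  have "\<exists>s \<delta> C n0. delta_scattered \<delta> s \<and> 0 \<le> C \<and> (\<forall>m\<ge>n0. \<forall>n\<ge>n0. s n \<noteq> s m \<longrightarrow>
      norm (integral {u..v} (\<lambda>x. cis (\<phi> n x - \<phi> m x))) \<le> C * \<bar>s n - s m\<bar> powr (- \<delta>))"
  proof (cases "L = 0")
    case False
    \<comment> \<open>Since \<open>b\<close> tends to infinity, only finitely many
      \<open>b n\<close> lie below the threshold \<open>B\<close>; this determines
      \<open>n0\<close>.\<close>
    obtain C B where C: "0 \<le> C" and osc: "\<And>Q \<beta> \<gamma>. \<lbrakk>degree Q \<le> D; B \<le> \<beta>; B \<le> \<gamma>; \<beta> \<noteq> \<gamma>\<rbrakk> \<Longrightarrow>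
       norm (integral {u..v} (\<lambda>x. cis (L * (g x powr \<beta> - g x powr \<gamma>) + poly Q x)))
       \<le> C * \<bar>\<beta> - \<gamma>\<bar> powr (- 1 / real (Suc D))"
      using oscillatory_powr_plus_poly[OF g g1 D uv nz False] by blast
    have "\<forall>\<^sub>F n in sequentially. B \<le> b n" using b(2) unfolding filterlim_at_top by blast
    then obtain n0 where "\<And>n. n0 \<le> n \<Longrightarrow> B \<le> b n" unfolding eventually_sequentially by blast
    then have "\<forall>m\<ge>n0. \<forall>n\<ge>n0. b n \<noteq> b m \<longrightarrow>
      norm (integral {u..v} (\<lambda>x. cis (\<phi> n x - \<phi> m x))) \<le> C * \<bar>b n - b m\<bar> powr (- (1 / real (Suc D)))"
      unfolding diff using osc[OF P_deg, of "b _" "b _"] by simp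
    moreover have "delta_scattered (1 / real (Suc D)) b"
      using b(1) unfolding scattered_def by auto
    ultimately show ?thesis using C by blast
  next
    case True
    then obtain i0 where "l i0 \<noteq> 0" using nonzero by blast
    then obtain s c where s: "scattered s" and c: "0 < c"
      and dom: "\<And>n m. \<exists>d\<in>{1..D}. c * \<bar>s n - s m\<bar> \<le> \<bar>coeff (P n m) d\<bar>"
      using scattered_dominating_sequence[of p D l i0 a, OF deg degD _ sc alt] unfolding P_def by blast
    define M where "M = max 1 (\<bar>u\<bar> + \<bar>v\<bar>)"
    have M: "1 \<le> M" "- M \<le> u" "v \<le> M" by (auto simp: M_def)
    obtain C where C: "0 \<le> C" and osc: "\<And>Q a b \<kappa> d. \<lbrakk>degree Q \<le> D; - M \<le> a; a \<le> b; b \<le> M; 0 < \<kappa>;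
       1 \<le> d; d \<le> D; \<kappa> \<le> \<bar>coeff Q d\<bar>\<rbrakk> \<Longrightarrow>
       norm (integral {a..b} (\<lambda>x. cis (poly Q x))) \<le> C * \<kappa> powr (- 1 / real D)"
      using oscillatory_poly[OF D M(1)] by blast
    have "norm (integral {u..v} (\<lambda>x. cis (\<phi> n x - \<phi> m x))) \<le>
        C * c powr (- 1 / real D) * \<bar>s n - s m\<bar> powr (- (1 / real D))" if "s n \<noteq> s m" for n m
    proof -
      obtain d where "d \<in> {1..D}" "c * \<bar>s n - s m\<bar> \<le> \<bar>coeff (P n m) d\<bar>" using dom by blast
      then have "norm (integral {u..v} (\<lambda>x. cis (poly (P n m) x))) \<le> C * (c * \<bar>s n - s m\<bar>) powr (- 1 / real D)"
        using that c uv M by (intro osc[OF P_deg, where d = d]) auto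
      then show ?thesis using True c by (simp add: diff powr_mult mult.assoc)
    qed
    moreover have "delta_scattered (1 / real D) s"
      using s D unfolding scattered_def by auto
    moreover have "0 \<le> C * c powr (- 1 / real D)" using C by simp
    ultimately show ?thesis by blast
  qed
  then obtain s \<delta> C n0 where s: "delta_scattered \<delta> s" and C: "0 \<le> C"
    and osc: "\<And>m n. \<lbrakk>n0 \<le> m; n0 \<le> n; s n \<noteq> s m\<rbrakk> \<Longrightarrow>
      norm (integral {u..v} (\<lambda>x. cis (\<phi> n x - \<phi> m x))) \<le> C * \<bar>s n - s m\<bar> powr (- \<delta>)"
    by blast
  obtain \<epsilon> where \<epsilon>: "0 < \<epsilon>" and ker: "\<forall>\<^sub>F N in sequentially.
        1 / (real N)\<^sup>2 *
          (\<Sum>n\<in>{1..N}. \<Sum>m\<in>{1..<n}.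
             if s n = s m then 1 else min (\<bar>s n - s m\<bar> powr (- \<delta>)) 1)
        \<le> 1 / ln (real N) powr (1 + \<epsilon>)"
    using s unfolding delta_scattered_def by blast
  have "AE x in lebesgue. x \<in> {u..v} \<longrightarrow> (\<lambda>N. (\<Sum>n\<in>{1..N}. cis (\<phi> n x)) / of_nat N) \<longlonglongrightarrow> 0"
  proof (rule metric_exponential_sums[OF uv cont _ _ \<epsilon> ker])
    show "0 \<le> C + (v - u)" using C uv by simp
    show "norm (integral {u..v} (\<lambda>x. cis (\<phi> n x - \<phi> m x))) \<le>
       (C + (v - u)) * (if s n = s m then 1 else min (\<bar>s n - s m\<bar> powr (- \<delta>)) 1)"
      if "n0 \<le> m" "m < n" for m n
      using that C uv osc[of m n] by (intro le_scatter_kernel len) auto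
  qed auto
  then show ?thesis by (simp add: \<phi>_def)
qed

text \<open>The set where \<open>f\<close> is non-zero is open, hence a union of countably many
  rational intervals free of zeros, and the zeros left out form a null set. Countability allows the
  local exceptional sets to be united.\<close>

lemma AE_rational_interval_cover:
  assumes f: "real_analytic f" "\<exists>x. f x \<noteq> 0"
    and local: "\<And>u v. u \<le> v \<Longrightarrow> (\<And>x. x \<in> {u..v} \<Longrightarrow> f x \<noteq> 0) \<Longrightarrow>
      AE x in lebesgue. x \<in> {u..v} \<longrightarrow> Q x"
  shows "AE x in lebesgue. Q x"
proof -
  have "AE x in lebesgue. \<forall>q r :: rat. of_rat q \<le> (of_rat r :: real) \<and> (\<forall>x\<in>{of_rat q..of_rat r}. f x \<noteq> 0) \<longrightarrow>
      x \<in> {of_rat q..of_rat r} \<longrightarrow> Q x"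
    unfolding AE_all_countable
  proof (intro allI)
    fix q r :: rat
    show "AE x in lebesgue. of_rat q \<le> (of_rat r :: real) \<and> (\<forall>x\<in>{of_rat q..of_rat r}. f x \<noteq> 0) \<longrightarrow>
      x \<in> {of_rat q..of_rat r} \<longrightarrow> Q x"
      using local[of "of_rat q" "of_rat r"]
      by (cases "of_rat q \<le> (of_rat r :: real) \<and> (\<forall>x\<in>{of_rat q..of_rat r}. f x \<noteq> 0)") auto
  qed
  moreover have "AE x in lebesgue. x \<notin> {x. f x = 0}"
    using real_analytic_zeros_negligible[OF f] by (intro AE_not_in) (simp add: negligible_iff_null_sets)
  ultimately show ?thesis
  proof eventually_elim
    case (elim x)
    then have "f x \<noteq> 0" by simp
    moreover have "isCont f x"
      using real_analytic_continuous_on[OF f(1), of UNIV] by (simp add: continuous_on_eq_continuous_at)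
    ultimately have "\<forall>\<^sub>F y in nhds x. f y \<noteq> 0"
      by (simp add: isCont_def eventually_nhds_conv_at tendsto_imp_eventually_ne)
    then obtain e where e: "0 < e" "\<And>y. dist y x < e \<Longrightarrow> f y \<noteq> 0"
      by (auto simp: eventually_nhds_metric)
    obtain q where q: "x - e < of_rat q" "of_rat q < x" using of_rat_dense[of "x - e" x] e by auto
    obtain r where r: "x < of_rat r" "of_rat r < x + e" using of_rat_dense[of x "x + e"] e by auto
    have "\<forall>y\<in>{of_rat q..of_rat r}. f y \<noteq> 0"
      using q r by (intro ballI e(2)) (auto simp: dist_real_def abs_less_iff)
    then show ?case using elim(1)[rule_format, of q r] q r by force
  qed
qed

theorem theorem1p10:
  fixes g :: "real \<Rightarrow> real" and b :: "nat \<Rightarrow> real"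
    and p :: "'k::finite \<Rightarrow> real poly" and a :: "'k \<Rightarrow> nat \<Rightarrow> real"
  assumes "\<forall>x. 1 < g x" and "real_analytic g" and "\<not> g constant_on UNIV"
    and "scattered b" and "filterlim b at_top sequentially"
    and "\<forall>i. degree (p i) > 0"
    and "\<forall>i. scattered (a i)"
    and "jointly_scattered a \<or>
         independent_poly_family (\<lambda>j :: 'k option. case j of None \<Rightarrow> 1 | Some i \<Rightarrow> p i)"
  shows "AE x in lebesgue.
           uniformly_distributed_mod1
             (\<lambda>n. \<chi> j :: 'k option.
                case j of None \<Rightarrow> g x powr b n | Some i \<Rightarrow> a i n * poly (p i) x)"
proof -
  let ?x = "\<lambda>x n. \<chi> j :: 'k option. case j of None \<Rightarrow> g x powr b n | Some i \<Rightarrow> a i n * poly (p i) x"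
  have "\<exists>x. deriv g x \<noteq> 0"
  proof (rule ccontr)
    assume "\<nexists>x. deriv g x \<noteq> 0"
    then have "\<And>x. DERIV g x :> 0" using real_analytic_DERIV[OF assms(2)] by metis
    then have "g x = g 0" for x by (intro DERIV_isconst_all) auto
    then show False using assms(3) by (auto simp: constant_on_def)
  qed
  \<comment> \<open>There are countably many integer frequency vectors, so a single null set of
    \<open>x\<close> serves for all of them, as the criterion at a fixed \<open>x\<close>
    requires.\<close>
  have "AE x in lebesgue. \<forall>k :: 'k option \<Rightarrow> int. k \<noteq> (\<lambda>_. 0) \<longrightarrow>
      (\<lambda>N. (\<Sum>n\<in>{1..N}. cis (2 * pi * (\<Sum>j\<in>UNIV. of_int (k j) * ?x x n $ j))) / of_nat N) \<longlonglongrightarrow> 0"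
    unfolding AE_all_countable
  proof
    fix k :: "'k option \<Rightarrow> int"
    show "AE x in lebesgue. k \<noteq> (\<lambda>_. 0) \<longrightarrow>
      (\<lambda>N. (\<Sum>n\<in>{1..N}. cis (2 * pi * (\<Sum>j\<in>UNIV. of_int (k j) * ?x x n $ j))) / of_nat N) \<longlonglongrightarrow> 0"
    proof (cases "k = (\<lambda>_. 0)")
      case False
      define L where "L = 2 * pi * of_int (k None)"
      define l where "l i = 2 * pi * of_int (k (Some i))" for i
      have phase: "2 * pi * (\<Sum>j\<in>UNIV. of_int (k j) * ?x x n $ j) =
          L * g x powr b n + (\<Sum>i\<in>UNIV. l i * (a i n * poly (p i) x))" for x n
        by (simp add: UNIV_option_conv sum.reindex L_def l_def sum_distrib_left distrib_left mult.assoc)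
      have "L \<noteq> 0 \<or> (\<exists>i. l i \<noteq> 0)"
      proof (rule ccontr)
        assume "\<not> ?thesis"
        then have "k j = 0" for j by (cases j) (auto simp: L_def l_def)
        then show False using False by auto
      qed
      then have "AE x in lebesgue. (\<lambda>N. (\<Sum>n\<in>{1..N}.
          cis (L * g x powr b n + (\<Sum>i\<in>UNIV. l i * (a i n * poly (p i) x)))) / of_nat N) \<longlonglongrightarrow> 0"
        by (rule AE_rational_interval_cover[OF real_analytic_deriv[OF assms(2)] \<open>\<exists>x. deriv g x \<noteq> 0\<close>
          exponential_sums_on_interval[OF spec[OF assms(1)] assms(2,4,5) spec[OF assms(6)] spec[OF assms(7)] assms(8)]])
      then show ?thesis unfolding phase by (rule eventually_mono) simp
    qed simp
  qed
  then show ?thesis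
  proof eventually_elim
    case (elim x)
    then show ?case by (intro weyl_criterion) blast
  qed
qed

end
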